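(* For each integer $k\geq 1$, the maximum of the Helly number $h(S)$ over all $2$-dimensional $k$-crystals $S\subset\mathbb{R}^2$ exists and equals $$\begin{cases}4 & \text{if } k=1,\\ 6 & \text{if } k=2,\\ 7 & \text{if } k=3,\\ 9 & \text{if } k=4,\\ 10 & \text{if } k=5,\\ k+6 & \text{if } k\geq 6.\end{cases}$$ That is, every $2$-dimensional $k$-crystal $S$ has $h(S)$ at most the displayed value, and for every $k\geq 1$ there is a $2$-dimensional $k$-crystal $S$ for which $h(S)$ equals the displayed value.
   Context: Helly number: for a non-empty set $S\subseteq\mathbb{R}^d$, the $S$-Helly number $h(S)$ is the minimal positive integer $n$ with the following property: for every finite family $\mathcal{F}$ of convex sets in $\mathbb{R}^d$ with at least $n$ members, if every $n$ sets from $\mathcal{F}$ have a common point belonging to $S$, then all sets from $\mathcal{F}$ have a common point belonging to $S$. If no such $n$ exists, $h(S)=\infty$. Crystal: let $\Lambda$ be a full rank lattice in $\mathbb{R}^d$, i.e. the set of all integer linear combinations of a basis of $\mathbb{R}^d$, and let $\mathbf{t}_1,\ldots,\mathbf{t}_k\in\mathbb{R}^d$ be vectors such that $\mathbf{t}_i-\mathbf{t}_j\notin\Lambda$ for all $i\neq j$. The set $\bigcup_{i=1}^k(\Lambda+\mathbf{t}_i)$ is called a $d$-dimensional $k$-crystal. *)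

theory Defs
  imports "HOL-Analysis.Analysis" "HOL-Library.Extended_Nat"
begin

(* Families of sets are rendered as sets of sets, so the n sets in "every n sets"
   are distinct. Allowing repeated members gives the same property: n members of an
   indexed family can always be chosen so as to realise min(n, number of distinct
   members) distinct sets. *)
definition helly_property :: "'a::real_vector set \<Rightarrow> nat \<Rightarrow> bool" where
  "helly_property S n \<longleftrightarrow>
     (\<forall>F. finite F \<and> (\<forall>C\<in>F. convex C) \<and> card F \<ge> n \<and>
          (\<forall>G. G \<subseteq> F \<and> card G = n \<longrightarrow> \<Inter>G \<inter> S \<noteq> {})
        \<longrightarrow> \<Inter>F \<inter> S \<noteq> {})"

(* On enat, Inf is the minimum of a non-empty set, and Inf {} = \<infinity>. *)
definition helly_number :: "'a::real_vector set \<Rightarrow> enat" where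
  "helly_number S = Inf {enat n | n. n \<ge> 1 \<and> helly_property S n}"

(* An independent set in a euclidean space is finite, so the sum is a genuine one. *)
definition full_rank_lattice :: "'a::euclidean_space set \<Rightarrow> bool" where
  "full_rank_lattice L \<longleftrightarrow>
     (\<exists>B. independent B \<and> span B = UNIV \<and>
          L = {\<Sum>b\<in>B. of_int (c b) *\<^sub>R b | c :: 'a \<Rightarrow> int. True})"

definition crystal :: "nat \<Rightarrow> 'a::euclidean_space set \<Rightarrow> bool" where
  "crystal k S \<longleftrightarrow>
     (\<exists>L t. full_rank_lattice L \<and>
            (\<forall>i\<in>{1..k}. \<forall>j\<in>{1..k}. i \<noteq> j \<longrightarrow> t i - t j \<notin> L) \<and>
            S = (\<Union>i\<in>{1..k}. (\<lambda>x. x + t i) ` L))"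

end

theory Submission
  imports Defs
begin

text \<open>For a locally finite set S the Helly number is the largest number of vertices of a polytope
  with vertices in S and no further points of S. In an empty polygon of a crystal call two vertices
  in the same translate of the lattice a chord. If there are at least two translates, chords whose
  directions agree modulo twice the lattice are equal up to sign, and a convex polygon has at most two
  chords with a given direction and length. The three nonzero parity classes thus give at most
  six chords, so the numbers n of vertices in the translates satisfy that the sum of
  n (n - 1) / 2 is at most 6, whence the sum of all n is at most min (k + 6, (3 k + 6) / 2).
  Equality for k > 5 is attained on the circle of radius slightly less than the covering radius of the
  hexagonal lattice: six translates meet it in two points each, and arcs remain whose
  points have no other lattice translate in the disc.\<close>

section \<open>Helly numbers and empty polytopes\<close>

text \<open>The parity argument has one obstacle: the diagonals of a parallelogram spanned by
  lattice vectors are congruent modulo twice the lattice without being equal up to sign. With a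
  single translate such a parallelogram may be empty; a second translate meets every closed
  parallelogram of this kind, which excludes it. Hence \<open>k \<ge> 2\<close> in the lemmas on
  congruent chords, while for \<open>k = 1\<close> the vertices themselves are counted by parity.
  The two bounds come from n (n - 1) / 2 >= n - 1, with equality for n = 1, 2, and n (n - 1) / 2 >=
  2 n - 3, with equality for n = 2, 3. Equality dictates the constructions: multiplicities 3, 3 for
  two translates, 3, 2, 2, 2 for four, and six times 2 followed by ones from six on. For three and
  five translates (3 k + 6) / 2 is rounded down, and dropping one double class leaves 3, 2, 2 and 2,
  2, 2, 2, 2.\<close>

definition empty_polytope :: "'a::real_vector set \<Rightarrow> 'a set \<Rightarrow> bool" where
  "empty_polytope S V \<longleftrightarrow> finite V \<and> V \<subseteq> S \<and> S \<inter> convex hull V \<subseteq> V \<and>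
     (\<forall>v\<in>V. v \<notin> convex hull (V - {v}))"

text \<open>The form in which emptiness is used below: a point of \<open>S\<close> shown to lie in
  the hull of a few vertices is one of these very vertices.\<close>

lemma empty_polytope_vertex:
  assumes "empty_polytope S V" "z \<in> S" "X \<subseteq> V" "z \<in> convex hull X"
  shows "z \<in> X"
proof (rule ccontr)
  assume "z \<notin> X"
  then have "X \<subseteq> V - {z}" using assms by auto
  then have "z \<in> convex hull (V - {z})" using assms(4) hull_mono by blast
  moreover have "z \<in> V" using assms hull_mono unfolding empty_polytope_def by blast
  ultimately show False using assms(1) unfolding empty_polytope_def by blast
qed

text \<open>\<open>y\<close> lies between \<open>z\<close> and some \<open>c\<close>, and
  \<open>z\<close> between \<open>y\<close> and some \<open>d\<close>, with \<open>c\<close> and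
  \<open>d\<close> in the hull of \<open>K\<close>. Eliminating \<open>z\<close> leaves
  \<open>y\<close> as a mean of \<open>c\<close> and \<open>d\<close>, unless its own coefficient
  \<open>s * t\<close> is 1, which forces \<open>y = z\<close>.\<close>

lemma convex_hull_anti_exchange:
  fixes y z :: "'a::real_vector"
  assumes "K \<noteq> {}" "y \<in> convex hull (insert z K)" "z \<in> convex hull (insert y K)" "y \<noteq> z"
  shows "y \<in> convex hull K"
proof -
  obtain s c where s: "0 \<le> s" "s \<le> 1" "c \<in> convex hull K" "y = s *\<^sub>R z + (1 - s) *\<^sub>R c"
  proof -
    obtain s s' c where "0 \<le> s" "0 \<le> s'" "s + s' = 1" "c \<in> convex hull K" "y = s *\<^sub>R z + s' *\<^sub>R c"
      using assms(2) unfolding convex_hull_insert[OF assms(1)] by blast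
    moreover from this have "s' = 1 - s" by simp
    ultimately show thesis by (intro that[of s c]) auto
  qed
  obtain t d where t: "0 \<le> t" "t \<le> 1" "d \<in> convex hull K" "z = t *\<^sub>R y + (1 - t) *\<^sub>R d"
  proof -
    obtain t t' d where "0 \<le> t" "0 \<le> t'" "t + t' = 1" "d \<in> convex hull K" "z = t *\<^sub>R y + t' *\<^sub>R d"
      using assms(3) unfolding convex_hull_insert[OF assms(1)] by blast
    moreover from this have "t' = 1 - t" by simp
    ultimately show thesis by (intro that[of t d]) auto
  qed
  have "s * t \<noteq> 1"
  proof
    assume "s * t = 1"
    then have "s = 1"
      using s t by (metis mult_left_le mult.commute order_antisym)
    then show False using s assms(4) by simp
  qed
  moreover have "s * t \<le> 1" using s t by (simp add: mult_le_one)
  ultimately have lt: "s * t < 1" by simp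
  define a where "a = s * (1 - t) / (1 - s * t)"
  define b where "b = (1 - s) / (1 - s * t)"
  have "s * t \<le> s" using s t by (simp add: mult_left_le)
  then have ab: "a \<ge> 0" "b \<ge> 0" "a + b = 1"
    using s t lt by (auto simp: a_def b_def field_simps)
  have "(1 - s * t) *\<^sub>R y = (s * (1 - t)) *\<^sub>R d + (1 - s) *\<^sub>R c"
  proof -
    have "y = s *\<^sub>R (t *\<^sub>R y + (1 - t) *\<^sub>R d) + (1 - s) *\<^sub>R c" using s(4) t(4) by simp
    then have "y = (s * t) *\<^sub>R y + ((s * (1 - t)) *\<^sub>R d + (1 - s) *\<^sub>R c)"
      by (simp add: scaleR_add_right add.assoc)
    then show ?thesis by (metis add_diff_cancel_left' scaleR_left_diff_distrib scaleR_one)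
  qed
  then have "y = (1 / (1 - s * t)) *\<^sub>R ((s * (1 - t)) *\<^sub>R d + (1 - s) *\<^sub>R c)"
  proof -
    have "(1 / (1 - s * t)) *\<^sub>R ((1 - s * t) *\<^sub>R y) = y" using lt by simp
    then show ?thesis using \<open>(1 - s * t) *\<^sub>R y = _\<close> by simp
  qed
  then have "y = a *\<^sub>R d + b *\<^sub>R c"
    by (simp add: a_def b_def scaleR_add_right)
  then show ?thesis
    using convexD[OF convex_convex_hull t(3) s(3) ab] by simp
qed

text \<open>A \<open>y\<close> is taken whose hull with \<open>K\<close> meets \<open>T\<close> in
  the fewest points. A further point \<open>z\<close> in that hull would span the same points of
  \<open>T\<close>, \<open>y\<close> included, and anti-exchange would place \<open>y\<close> in the
  hull of \<open>K\<close>.\<close>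

lemma convex_subset_extension:
  assumes "finite T" "K \<subseteq> T" "T \<inter> convex hull K \<subseteq> K" "K \<noteq> T"
  shows "\<exists>y\<in>T - K. T \<inter> convex hull (insert y K) \<subseteq> insert y K"
proof (cases "K = {}")
  case True
  then show ?thesis using assms by auto
next
  case False
  define g where "g y = card (T \<inter> convex hull (insert y K))" for y
  obtain y where y: "y \<in> T - K" and min: "\<And>z. z \<in> T - K \<Longrightarrow> g y \<le> g z"
  proof -
    have "T - K \<noteq> {}" "finite (T - K)" using assms by auto
    then show thesis
      using that[of "arg_min_on g (T - K)"] arg_min_if_finite(1) arg_min_least by metis
  qed
  have "z \<in> insert y K" if z: "z \<in> T" "z \<in> convex hull (insert y K)" for z
  proof (rule ccontr)
    assume n: "z \<notin> insert y K"
    have sub: "convex hull (insert z K) \<subseteq> convex hull (insert y K)"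
    proof (rule hull_minimal)
      show "insert z K \<subseteq> convex hull (insert y K)"
        using z(2) hull_subset[of "insert y K" convex] by auto
    qed (rule convex_convex_hull)
    have "T \<inter> convex hull (insert z K) = T \<inter> convex hull (insert y K)"
      using sub min[of z] z n assms(1) unfolding g_def
      by (intro card_seteq) auto
    moreover have "y \<in> convex hull (insert y K)" by (simp add: hull_inc)
    ultimately have "y \<in> convex hull (insert z K)" using y by blast
    then have "y \<in> convex hull K"
      using convex_hull_anti_exchange[OF False _ z(2)] n by auto
    then show False using y assms(3) by auto
  qed
  then show ?thesis using y by blast
qed

text \<open>A family of convex sets critical for S is replaced by traces on a finite set T, and these
  are enlarged as far as possible while the intersection stays empty. Each maximal trace can then
  be extended by a single point, and these points are the vertices of an empty polytope.\<close>

lemma helly_property_if_empty_polytopes_small: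
  fixes S :: "'a::real_vector set"
  assumes fin: "\<And>X. finite X \<Longrightarrow> finite (S \<inter> convex hull X)"
    and small: "\<And>V. empty_polytope S V \<Longrightarrow> card V \<le> m"
  shows "helly_property S m"
  unfolding helly_property_def
proof (intro allI impI, elim conjE, rule ccontr)
  fix F :: "'a set set"
  assume F: "finite F" "\<forall>C\<in>F. convex C" "m \<le> card F"
    and sub: "\<forall>G. G \<subseteq> F \<and> card G = m \<longrightarrow> \<Inter>G \<inter> S \<noteq> {}"
    and "\<not> \<Inter>F \<inter> S \<noteq> {}"
  then have empty: "\<Inter>F \<inter> S = {}" by simp
  define A where "A = {G. G \<subseteq> F \<and> \<Inter>G \<inter> S = {}}"
  have "finite A" "F \<in> A" using F(1) empty by (auto simp: A_def)
  then obtain G where "G \<in> A" and Gmin: "\<And>H. H \<in> A \<Longrightarrow> H \<subseteq> G \<Longrightarrow> G = H"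
    using finite_has_minimal[of A] by auto
  then have G: "G \<subseteq> F" "\<Inter>G \<inter> S = {}" by (auto simp: A_def)
  have finG: "finite G" using G F(1) finite_subset by blast
  have cardG: "card G > m"
  proof (rule ccontr)
    assume "\<not> card G > m"
    then obtain H where "G \<subseteq> H" "H \<subseteq> F" "card H = m"
      using exists_subset_between[of G m F] G F by auto
    moreover from this have "\<Inter>H \<inter> S \<subseteq> \<Inter>G \<inter> S" by (intro Int_mono Inter_anti_mono) auto
    ultimately show False using sub G(2) by (metis subset_empty)
  qed
  then have "G \<noteq> {}" by auto
  have "\<forall>C\<in>G. \<exists>x. x \<in> \<Inter>(G - {C}) \<inter> S"
  proof (rule ballI, rule ccontr)
    fix C assume C: "C \<in> G"
    assume "\<nexists>x. x \<in> \<Inter>(G - {C}) \<inter> S"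
    then have "G - {C} \<in> A" using G(1) unfolding A_def by blast
    then have "G = G - {C}" using Gmin by blast
    then show False using C by blast
  qed
  from bchoice[OF this] obtain x where x: "\<And>C. C \<in> G \<Longrightarrow> x C \<in> \<Inter>(G - {C}) \<inter> S" by blast
  \<comment> \<open>All further points are taken from this finite set; the witness
    \<open>x C\<close> lies in every member of \<open>G\<close> except \<open>C\<close>.\<close>
  define T where "T = S \<inter> convex hull (x ` G)"
  have finT: "finite T" using fin finG by (simp add: T_def)
  have xT: "x C \<in> T" if "C \<in> G" for C
    using x[OF that] that by (auto simp: T_def hull_inc)
  \<comment> \<open>The traces are convex relative to \<open>T\<close>. Keeping the witnesses inside
    ensures that no trace is all of \<open>T\<close>, as \<open>x C\<close> would then be common to
    all.\<close>
  define P where "P K \<longleftrightarrow> (\<forall>C\<in>G. K C \<subseteq> T \<and> T \<inter> convex hull (K C) \<subseteq> K C) \<and>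
      (\<forall>C\<in>G. \<forall>D\<in>G. C \<noteq> D \<longrightarrow> x D \<in> K C) \<and> (\<Inter>C\<in>G. K C) = {}" for K :: "'a set \<Rightarrow> 'a set"
  have P0: "P (\<lambda>C. T \<inter> C)"
    unfolding P_def
  proof (intro conjI ballI impI)
    fix C assume C: "C \<in> G"
    then have "convex C" using F(2) G by auto
    then have "convex hull (T \<inter> C) \<subseteq> C" by (simp add: hull_minimal)
    then show "T \<inter> convex hull (T \<inter> C) \<subseteq> T \<inter> C" by blast
  next
    fix C D assume "C \<in> G" "D \<in> G" "C \<noteq> D"
    then show "x D \<in> T \<inter> C" using x[of D] xT[of D] by blast
  next
    show "(\<Inter>C\<in>G. T \<inter> C) = {}" using G(2) \<open>G \<noteq> {}\<close> by (auto simp: T_def)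
  qed auto
  have "\<exists>K. P K \<and> (\<forall>K'. P K' \<longrightarrow> (\<Sum>C\<in>G. card (K' C)) \<le> (\<Sum>C\<in>G. card (K C)))"
  proof (rule ex_has_greatest_nat[where P = P and k = "\<lambda>C. T \<inter> C" and b = "card G * card T + 1"])
    show "P (\<lambda>C. T \<inter> C)" by (rule P0)
    show "\<forall>K. P K \<longrightarrow> (\<Sum>C\<in>G. card (K C)) < card G * card T + 1"
    proof (intro allI impI)
      fix K assume "P K"
      then have "\<And>C. C \<in> G \<Longrightarrow> card (K C) \<le> card T"
        using finT by (auto simp: P_def intro!: card_mono)
      then show "(\<Sum>C\<in>G. card (K C)) < card G * card T + 1"
        using sum_bounded_above[of G "\<lambda>C. card (K C)" "card T"] by simp
    qed
  qed
  then obtain K where K: "P K"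
    and Kmax: "\<And>K'. P K' \<Longrightarrow> (\<Sum>C\<in>G. card (K' C)) \<le> (\<Sum>C\<in>G. card (K C))" by blast
  have Kempty: "(\<Inter>C\<in>G. K C) = {}" using K by (simp add: P_def)
  have "\<exists>y. y \<in> T - K C \<and> T \<inter> convex hull (insert y (K C)) \<subseteq> insert y (K C) \<and>
          (\<forall>D\<in>G. D \<noteq> C \<longrightarrow> y \<in> K D)" if C: "C \<in> G" for C
  proof -
    have KC: "K C \<subseteq> T" "T \<inter> convex hull (K C) \<subseteq> K C" using K C by (auto simp: P_def)
    have "K C \<noteq> T"
    proof
      assume "K C = T"
      moreover have "x C \<in> K D" if "D \<in> G" "D \<noteq> C" for D using K C that unfolding P_def by blast
      ultimately have "x C \<in> (\<Inter>D\<in>G. K D)" using xT[OF C] by blast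
      then show False using Kempty by blast
    qed
    then obtain y where y: "y \<in> T - K C" "T \<inter> convex hull (insert y (K C)) \<subseteq> insert y (K C)"
      using convex_subset_extension[OF finT KC] by blast
    define K' where "K' = K(C := insert y (K C))"
    have "(\<Sum>D\<in>G. card (K D)) < (\<Sum>D\<in>G. card (K' D))"
    proof (rule sum_strict_mono_ex1[OF finG])
      have "finite (K C)" using KC finT finite_subset by blast
      then show "\<forall>D\<in>G. card (K D) \<le> card (K' D)" and "\<exists>D\<in>G. card (K D) < card (K' D)"
        using y(1) C by (auto simp: K'_def card_insert_if)
    qed
    \<comment> \<open>\<open>K'\<close> has larger total size, and only the empty intersection can
      fail; the resulting common point can only be \<open>y\<close>.\<close>
    then have "\<not> P K'" using Kmax[of K'] by auto
    moreover have "\<forall>D\<in>G. K' D \<subseteq> T \<and> T \<inter> convex hull (K' D) \<subseteq> K' D"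
      using y K by (auto simp: P_def K'_def)
    moreover have "\<forall>D\<in>G. \<forall>E\<in>G. D \<noteq> E \<longrightarrow> x E \<in> K' D"
      using K by (auto simp: P_def K'_def)
    ultimately obtain z where z: "z \<in> (\<Inter>D\<in>G. K' D)" by (auto simp: P_def)
    then have zD: "\<And>D. D \<in> G \<Longrightarrow> D \<noteq> C \<Longrightarrow> z \<in> K D" by (auto simp: K'_def split: if_splits)
    have zC: "z = y \<or> z \<in> K C" using z C by (auto simp: K'_def)
    have "z \<notin> K C"
    proof
      assume "z \<in> K C"
      then have "z \<in> (\<Inter>D\<in>G. K D)" using zD by auto
      then show False using Kempty by blast
    qed
    then show ?thesis using y zC zD by blast
  qed
  then obtain y where y: "\<And>C. C \<in> G \<Longrightarrow> y C \<in> T - K C"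
      "\<And>C. C \<in> G \<Longrightarrow> T \<inter> convex hull (insert (y C) (K C)) \<subseteq> insert (y C) (K C)"
      "\<And>C D. C \<in> G \<Longrightarrow> D \<in> G \<Longrightarrow> D \<noteq> C \<Longrightarrow> y C \<in> K D" by metis
  have "inj_on y G"
    by (intro inj_onI) (metis DiffE y(1) y(3))
  then have "card (y ` G) = card G" by (rule card_image)
  moreover have "empty_polytope S (y ` G)"
    unfolding empty_polytope_def
  proof (intro conjI)
    show "finite (y ` G)" using finG by simp
    show "y ` G \<subseteq> S" using y(1) by (auto simp: T_def)
    show "S \<inter> convex hull (y ` G) \<subseteq> y ` G"
    proof
      fix z assume z: "z \<in> S \<inter> convex hull (y ` G)"
      have "convex hull (y ` G) \<subseteq> convex hull (x ` G)"
        using y(1) by (intro hull_minimal) (auto simp: T_def)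
      then have zT: "z \<in> T" using z by (auto simp: T_def)
      \<comment> \<open>Every chosen point except \<open>y C\<close> lies in \<open>K C\<close>, so
        \<open>z\<close> is in the hull of \<open>insert (y C) (K C)\<close> and can only be
        \<open>y C\<close>.\<close>
      obtain C where C: "C \<in> G" "z \<notin> K C"
        using Kempty by blast
      have "y ` G \<subseteq> insert (y C) (K C)" using y(3) C by blast
      then have "z \<in> convex hull (insert (y C) (K C))" using z hull_mono by blast
      then show "z \<in> y ` G" using y(2)[OF C(1)] zT C by blast
    qed
    show "\<forall>v\<in>y ` G. v \<notin> convex hull (y ` G - {v})"
    proof safe
      fix C assume C: "C \<in> G" and h: "y C \<in> convex hull (y ` G - {y C})"
      have "y ` G - {y C} \<subseteq> K C" using y(3) C by blast
      then have "y C \<in> convex hull (K C)" using h hull_mono by blast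
      then show False using y(1)[OF C] K C by (auto simp: P_def)
    qed
  qed
  ultimately show False using small[of "y ` G"] cardG by auto
qed

text \<open>The counterexample is the family of hulls of \<open>V\<close> with one vertex removed:
  any \<open>m\<close> of them share a vertex removed from none of them, while a point of
  \<open>S\<close> common to all would be a vertex, and each vertex is missing from its own
  member.\<close>

lemma empty_polytope_not_helly_property:
  assumes V: "empty_polytope S V" and m: "m < card V"
  shows "\<not> helly_property S m"
proof
  assume h: "helly_property S m"
  define C where "C v = convex hull (V - {v})" for v
  have C: "w \<in> C v \<longleftrightarrow> w \<noteq> v" if "v \<in> V" "w \<in> V" for v w
    using V that by (auto simp: empty_polytope_def C_def hull_inc)
  have inj: "inj_on C V"
    by (intro inj_onI) (metis C)
  have finV: "finite V" using V by (simp add: empty_polytope_def)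
  have "\<Inter>(C ` V) \<inter> S \<noteq> {}"
  proof (rule h[unfolded helly_property_def, rule_format], intro conjI allI impI)
    show "finite (C ` V)" using finV by simp
    show "\<forall>D\<in>C ` V. convex D" by (auto simp: C_def)
    show "m \<le> card (C ` V)" using m by (simp add: card_image inj)
    fix G assume G: "G \<subseteq> C ` V \<and> card G = m"
    then obtain W where W: "W \<subseteq> V" "G = C ` W" by (auto simp: subset_image_iff)
    then have "card W = m" using G inj by (metis card_image inj_on_subset)
    then have "W \<noteq> V" using m by auto
    then obtain v where v: "v \<in> V" "v \<notin> W" using W by blast
    then have "v \<in> \<Inter>G" using W C by auto
    moreover have "v \<in> S" using v V by (auto simp: empty_polytope_def)
    ultimately show "\<Inter>G \<inter> S \<noteq> {}" by blast
  qed
  then obtain z where z: "z \<in> S" "\<And>v. v \<in> V \<Longrightarrow> z \<in> C v" by auto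
  have "V \<noteq> {}" using m by auto
  then obtain v where "v \<in> V" by auto
  then have "z \<in> convex hull V" using z(2)[of v] hull_mono[of "V - {v}" V] by (auto simp: C_def)
  then have "z \<in> V" using z(1) V by (auto simp: empty_polytope_def)
  then show False using z(2) C by blast
qed

lemma helly_number_le:
  assumes "helly_property S m" "1 \<le> m"
  shows "helly_number S \<le> enat m"
  unfolding helly_number_def using assms by (intro Inf_lower) auto

lemma helly_number_ge:
  assumes "empty_polytope S V"
  shows "enat (card V) \<le> helly_number S"
  unfolding helly_number_def
  using empty_polytope_not_helly_property[OF assms]
  by (intro Inf_greatest) (auto simp: not_less[symmetric])

section \<open>Planar lattices\<close>

definition det2 :: "real ^ 2 \<Rightarrow> real ^ 2 \<Rightarrow> real" where
  "det2 v w = v $ 1 * w $ 2 - v $ 2 * w $ 1"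

lemma det2_zero_imp_parallel:
  assumes "det2 v w = 0" "v \<noteq> 0"
  obtains c where "w = c *\<^sub>R v"
proof (cases "v $ 1 = 0")
  case True
  then have "v $ 2 \<noteq> 0" using assms(2) by (auto simp: vec_eq_iff forall_2)
  then have "w = (w $ 2 / v $ 2) *\<^sub>R v"
    using assms(1) True by (auto simp: vec_eq_iff forall_2 det2_def)
  then show thesis by (rule that)
next
  case False
  then have "w = (w $ 1 / v $ 1) *\<^sub>R v"
    using assms(1) by (auto simp: vec_eq_iff forall_2 det2_def field_simps)
  then show thesis by (rule that)
qed

lemma det2_nonzero_coordinates:
  assumes "det2 v w \<noteq> 0"
  obtains a b where "z = a *\<^sub>R v + b *\<^sub>R w"
proof -
  \<comment> \<open>Cramer's rule without division.\<close>
  have "det2 v w *\<^sub>R z = det2 z w *\<^sub>R v + det2 v z *\<^sub>R w"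
    by (simp add: vec_eq_iff forall_2 det2_def algebra_simps)
  then have "z = inverse (det2 v w) *\<^sub>R (det2 z w *\<^sub>R v + det2 v z *\<^sub>R w)"
    using assms by (metis scaleR_scaleR left_inverse scaleR_one)
  then have "z = (det2 z w / det2 v w) *\<^sub>R v + (det2 v z / det2 v w) *\<^sub>R w"
    by (simp add: scaleR_add_right divide_inverse mult.commute)
  then show thesis by (rule that)
qed

text \<open>Unnormalised weights let later steps pass coefficients such as \<open>1\<close> and
  \<open>c\<close> without dividing.\<close>

lemma weighted_mean_in_convex_hull:
  fixes z :: "'a::real_vector"
  assumes "p \<in> convex hull X" "q \<in> convex hull X" "0 \<le> a" "0 \<le> b" "0 < a + b"
    and "(a + b) *\<^sub>R z = a *\<^sub>R p + b *\<^sub>R q"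
  shows "z \<in> convex hull X"
proof -
  have "z = inverse (a + b) *\<^sub>R (a *\<^sub>R p + b *\<^sub>R q)"
    using assms(5) unfolding assms(6)[symmetric] by simp
  also have "\<dots> = (a / (a + b)) *\<^sub>R p + (b / (a + b)) *\<^sub>R q"
    by (simp add: scaleR_add_right divide_inverse mult.commute)
  also have "\<dots> \<in> convex hull X"
    using assms by (intro convexD convex_convex_hull) (auto simp flip: add_divide_distrib)
  finally show ?thesis .
qed

text \<open>\<open>par\<close> labels classes modulo twice the lattice. Of the basis two
  consequences are kept: the type of \<open>par\<close> allows only four classes, and bounded sets
  meet \<open>L\<close> in finitely many points.\<close>

locale planar_lattice =
  fixes L :: "(real ^ 2) set" and par :: "real ^ 2 \<Rightarrow> bool \<times> bool"
  assumes zero: "0 \<in> L"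
    and add: "u \<in> L \<Longrightarrow> v \<in> L \<Longrightarrow> u + v \<in> L"
    and minus: "u \<in> L \<Longrightarrow> - u \<in> L"
    and parity: "u \<in> L \<Longrightarrow> v \<in> L \<Longrightarrow> par u = par v \<Longrightarrow> \<exists>w\<in>L. u - v = 2 *\<^sub>R w"
    and discrete: "bounded A \<Longrightarrow> finite (L \<inter> A)"
begin

lemma diff: "u \<in> L \<Longrightarrow> v \<in> L \<Longrightarrow> u - v \<in> L"
  using add[of u "- v"] minus by simp

lemma of_nat_scale: "u \<in> L \<Longrightarrow> of_nat n *\<^sub>R u \<in> L"
  by (induction n) (auto simp: zero add scaleR_add_left)

lemma of_int_scale: "u \<in> L \<Longrightarrow> of_int m *\<^sub>R u \<in> L"
  using of_nat_scale[of u "nat m"] of_nat_scale[of "- u" "nat (- m)"] minus[of u]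
  by (cases "m \<ge> 0") (auto simp: of_nat_nat)

end

lemma full_rank_lattice_planar:
  assumes "full_rank_lattice (L :: (real ^ 2) set)"
  shows "\<exists>par. planar_lattice L par"
proof -
  obtain B where B: "independent B" "span B = UNIV"
      "L = {\<Sum>b\<in>B. of_int (c b) *\<^sub>R b | c :: real ^ 2 \<Rightarrow> int. True}"
    using assms unfolding full_rank_lattice_def by blast
  have "dim (UNIV :: (real ^ 2) set) = 2" by simp
  then have "card B = 2" using B(1,2) by (metis basis_card_eq_dim subset_UNIV order_refl)
  then obtain b1 b2 where b: "B = {b1, b2}" "b1 \<noteq> b2" by (auto simp: card_2_iff)
  have L: "v \<in> L \<longleftrightarrow> (\<exists>m n. v = of_int m *\<^sub>R b1 + of_int n *\<^sub>R b2)" for v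
  proof
    assume "v \<in> L"
    then show "\<exists>m n. v = of_int m *\<^sub>R b1 + of_int n *\<^sub>R b2" using B(3) b by auto
  next
    assume "\<exists>m n. v = of_int m *\<^sub>R b1 + of_int n *\<^sub>R b2"
    then obtain m n where v: "v = of_int m *\<^sub>R b1 + of_int n *\<^sub>R b2" by blast
    define c where "c = (\<lambda>x. if x = b1 then m else n)"
    have "v = (\<Sum>b\<in>B. of_int (c b) *\<^sub>R b)" using b v by (simp add: c_def)
    then show "v \<in> L" using B(3) by blast
  qed
  obtain f where f: "linear f" "\<forall>x\<in>B. f x = (if x = b1 then 1 else 0 :: real)"
    using linear_independent_extend[OF B(1), of "\<lambda>x. if x = b1 then 1 else 0 :: real"] by blast
  obtain g where g: "linear g" "\<forall>x\<in>B. g x = (if x = b2 then 1 else 0 :: real)"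
    using linear_independent_extend[OF B(1), of "\<lambda>x. if x = b2 then 1 else 0 :: real"] by blast
  have fv: "f (r *\<^sub>R b1 + s *\<^sub>R b2) = r" "g (r *\<^sub>R b1 + s *\<^sub>R b2) = s" for r s
    using f(2) g(2) b by (auto simp: linear_add[OF f(1)] linear_add[OF g(1)] linear_scale[OF f(1)] linear_scale[OF g(1)])
  \<comment> \<open>\<open>f\<close> and \<open>g\<close> are the coordinate functionals of the
    basis, integral on \<open>L\<close>; the floor only turns their values into integers.\<close>
  define par where "par v = (even \<lfloor>f v\<rfloor>, even \<lfloor>g v\<rfloor>)" for v
  have "planar_lattice L par"
  proof
    have "0 = of_int 0 *\<^sub>R b1 + of_int 0 *\<^sub>R b2" by simp
    then show "0 \<in> L" using L by blast
  next
    fix u v assume "u \<in> L" "v \<in> L"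
    then obtain m n m' n' where "u = of_int m *\<^sub>R b1 + of_int n *\<^sub>R b2" "v = of_int m' *\<^sub>R b1 + of_int n' *\<^sub>R b2"
      using L by blast
    then have "u + v = of_int (m + m') *\<^sub>R b1 + of_int (n + n') *\<^sub>R b2"
      by (simp add: scaleR_add_left)
    then show "u + v \<in> L" using L by blast
  next
    fix u assume "u \<in> L"
    then obtain m n where "u = of_int m *\<^sub>R b1 + of_int n *\<^sub>R b2" using L by blast
    then have "- u = of_int (- m) *\<^sub>R b1 + of_int (- n) *\<^sub>R b2" by simp
    then show "- u \<in> L" using L by blast
  next
    fix u v assume uv: "u \<in> L" "v \<in> L" "par u = par v"
    then obtain m n m' n' where u: "u = of_int m *\<^sub>R b1 + of_int n *\<^sub>R b2"
        and v: "v = of_int m' *\<^sub>R b1 + of_int n' *\<^sub>R b2"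
      using L by blast
    have "even (m - m')" "even (n - n')" using uv(3) by (auto simp: par_def u v fv)
    then obtain i j where ij: "m = m' + 2 * i" "n = n' + 2 * j"
      by (metis add.commute diff_add_cancel dvdE)
    have "u - v = 2 *\<^sub>R (of_int i *\<^sub>R b1 + of_int j *\<^sub>R b2)"
      by (simp add: u v ij algebra_simps)
    then show "\<exists>w\<in>L. u - v = 2 *\<^sub>R w" using L by blast
  next
    fix A :: "(real ^ 2) set" assume "bounded A"
    then have "bounded (f ` A)" "bounded (g ` A)"
      using f(1) g(1) by (auto intro!: bounded_linear_image simp: linear_conv_bounded_linear)
    then obtain M N where M: "\<And>x. x \<in> A \<Longrightarrow> \<bar>f x\<bar> \<le> M" and N: "\<And>x. x \<in> A \<Longrightarrow> \<bar>g x\<bar> \<le> N"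
      unfolding bounded_iff by auto
    have "L \<inter> A \<subseteq> (\<lambda>(m, n). of_int m *\<^sub>R b1 + of_int n *\<^sub>R b2) ` ({-\<lceil>M\<rceil>..\<lceil>M\<rceil>} \<times> {-\<lceil>N\<rceil>..\<lceil>N\<rceil>})"
    proof
      fix u assume u: "u \<in> L \<inter> A"
      then obtain m n where m: "u = of_int m *\<^sub>R b1 + of_int n *\<^sub>R b2" using L by blast
      have "\<bar>of_int m\<bar> \<le> M" "\<bar>of_int n\<bar> \<le> N" using M[of u] N[of u] u by (auto simp: m fv)
      then have "m \<in> {-\<lceil>M\<rceil>..\<lceil>M\<rceil>}" "n \<in> {-\<lceil>N\<rceil>..\<lceil>N\<rceil>}"
        by (auto simp: abs_le_iff) linarith+
      then show "u \<in> (\<lambda>(m, n). of_int m *\<^sub>R b1 + of_int n *\<^sub>R b2) ` ({-\<lceil>M\<rceil>..\<lceil>M\<rceil>} \<times> {-\<lceil>N\<rceil>..\<lceil>N\<rceil>})"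
        using m by (intro image_eqI[of _ _ "(m, n)"]) auto
    qed
    then show "finite (L \<inter> A)" by (rule finite_subset) auto
  qed
  then show ?thesis by blast
qed

section \<open>Empty polygons in crystals\<close>

locale empty_crystal_polygon = planar_lattice +
  fixes k :: nat and t :: "nat \<Rightarrow> real ^ 2" and S V :: "(real ^ 2) set"
  assumes incongruent: "\<And>i j. i \<in> {1..k} \<Longrightarrow> j \<in> {1..k} \<Longrightarrow> i \<noteq> j \<Longrightarrow> t i - t j \<notin> L"
    and S_def: "S = (\<Union>i\<in>{1..k}. (\<lambda>x. x + t i) ` L)"
    and polygon: "empty_polytope S V"
begin

lemma S_iff: "x \<in> S \<longleftrightarrow> (\<exists>i\<in>{1..k}. x - t i \<in> L)"
proof
  assume "\<exists>i\<in>{1..k}. x - t i \<in> L"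
  then obtain i where "i \<in> {1..k}" "x - t i \<in> L" by blast
  moreover have "x = (x - t i) + t i" by simp
  ultimately show "x \<in> S" unfolding S_def by blast
qed (force simp: S_def)

lemma V_in_S: "x \<in> V \<Longrightarrow> x \<in> S"
  using polygon by (auto simp: empty_polytope_def)

lemma translate_in_S:
  assumes "x \<in> S" "u \<in> L"
  shows "x + u \<in> S"
proof -
  obtain i where i: "i \<in> {1..k}" "x - t i \<in> L" using assms(1) by (auto simp: S_iff)
  have "(x - t i) + u \<in> L" using i(2) assms(2) by (rule add)
  moreover have "(x - t i) + u = x + u - t i" by simp
  ultimately show ?thesis using i(1) by (auto simp: S_iff)
qed

lemmas vertex = empty_polytope_vertex[OF polygon, rotated 2]

text \<open>The midpoint of two distinct such vertices would lie in the translate of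
  \<open>y\<close> and be a further point of \<open>S\<close>. The base point \<open>a\<close> is a
  translation vector in one use and a vertex in the other.\<close>

lemma same_parity_distinct:
  assumes "x \<in> V" "y \<in> V" "x - a \<in> L" "y - a \<in> L" "par (x - a) = par (y - a)"
  shows "x = y"
proof (rule ccontr)
  assume "x \<noteq> y"
  obtain w where w: "w \<in> L" "(x - a) - (y - a) = 2 *\<^sub>R w" using parity assms by blast
  have x: "x = y + 2 *\<^sub>R w" using w(2) by (simp add: algebra_simps)
  have "y + w \<in> convex hull {x, y}"
    by (rule weighted_mean_in_convex_hull[of x _ y 1 1]) (auto simp: hull_inc x scaleR_2)
  then have "y + w \<in> {x, y}"
    by (rule vertex) (use assms V_in_S translate_in_S w in auto)
  then show False using \<open>x \<noteq> y\<close> x by (auto simp: scaleR_2)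
qed

lemma parity_nonzero:
  assumes "x \<in> V" "y \<in> V" "x \<noteq> y" "x - y \<in> L"
  shows "par (x - y) \<noteq> par 0"
  using same_parity_distinct[of x y y] assms zero by auto

text \<open>\<open>det2 v\<close> orders the lines parallel to \<open>v\<close>, and
  \<open>m\<close> is a point of the segment from \<open>x\<close> to \<open>z\<close> on the line
  of the middle chord. Depending on the side of \<open>m\<close>, either \<open>y\<close> is in the
  hull of \<open>x\<close>, \<open>z\<close>, \<open>y + v\<close>, or \<open>y + v\<close> is in
  the hull of \<open>y\<close>, \<open>x + v\<close>, \<open>z + v\<close>.\<close>

lemma three_translates:
  assumes "x \<in> V" "y \<in> V" "z \<in> V" "x + v \<in> V" "y + v \<in> V" "z + v \<in> V" "v \<noteq> 0"
    and le: "det2 v x \<le> det2 v y" "det2 v y \<le> det2 v z"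
    and ne: "y \<noteq> x" "y \<noteq> z"
  shows False
proof -
  obtain r where r: "0 \<le> r" "r \<le> 1" "det2 v y = (1 - r) * det2 v x + r * det2 v z"
  proof (cases "det2 v x = det2 v z")
    case True
    then show thesis using le by (intro that[of 0]) auto
  next
    case False
    then show thesis using le
      by (intro that[of "(det2 v y - det2 v x) / (det2 v z - det2 v x)"], simp, simp)
         (simp add: left_diff_distrib nonzero_eq_divide_eq, simp add: divide_simps, simp add: algebra_simps)
  qed
  define m where "m = (1 - r) *\<^sub>R x + r *\<^sub>R z"
  have "det2 v (y - m) = 0" using r(3) by (simp add: m_def det2_def algebra_simps)
  then obtain c where "y - m = c *\<^sub>R v" using det2_zero_imp_parallel \<open>v \<noteq> 0\<close> by blast
  then have m_eq: "m = y - c *\<^sub>R v" by (simp add: algebra_simps)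
  have m: "m \<in> convex hull {x, z}"
    unfolding m_def using r by (intro convexD convex_convex_hull hull_inc) auto
  show False
  proof (cases "c \<ge> 0")
    case True
    have "m \<in> convex hull {x, z, y + v}" using m hull_mono[of "{x, z}" "{x, z, y + v}"] by blast
    then have "y \<in> convex hull {x, z, y + v}"
      by (rule weighted_mean_in_convex_hull[of m _ "y + v" 1 c]) (use True in \<open>auto simp: hull_inc m_eq algebra_simps\<close>)
    then have "y \<in> {x, z, y + v}" by (rule vertex) (use assms V_in_S in auto)
    then show False using ne \<open>v \<noteq> 0\<close> by auto
  next
    case False
    have "m + v = (1 - r) *\<^sub>R (x + v) + r *\<^sub>R (z + v)" by (simp add: m_def algebra_simps)
    also have "\<dots> \<in> convex hull {y, x + v, z + v}"
      using r by (intro convexD convex_convex_hull hull_inc) auto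
    finally have "m + v \<in> convex hull {y, x + v, z + v}" .
    then have "y + v \<in> convex hull {y, x + v, z + v}"
      by (rule weighted_mean_in_convex_hull[of "m + v" _ y 1 "- c"]) (use False in \<open>auto simp: hull_inc m_eq algebra_simps\<close>)
    then have "y + v \<in> {y, x + v, z + v}" by (rule vertex) (use assms V_in_S in auto)
    then show False using ne \<open>v \<noteq> 0\<close> by auto
  qed
qed

lemma at_most_two_translates:
  assumes "v \<noteq> 0"
  shows "card {x \<in> V. x + v \<in> V} \<le> 2"
proof (rule ccontr)
  assume "\<not> ?thesis"
  then have "3 \<le> card {x \<in> V. x + v \<in> V}" by simp
  then obtain X where X: "X \<subseteq> {x \<in> V. x + v \<in> V}" "card X = 3"
    by (meson obtain_subset_with_card_n)
  then obtain a b c where abc: "X = {a, b, c}" "a \<noteq> b" "b \<noteq> c" "a \<noteq> c"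
    by (auto simp: card_3_iff)
  have mem: "a \<in> V" "b \<in> V" "c \<in> V" "a + v \<in> V" "b + v \<in> V" "c + v \<in> V"
    using X abc by auto
  consider "det2 v a \<le> det2 v b \<and> det2 v b \<le> det2 v c" | "det2 v a \<le> det2 v c \<and> det2 v c \<le> det2 v b"
    | "det2 v b \<le> det2 v a \<and> det2 v a \<le> det2 v c" | "det2 v b \<le> det2 v c \<and> det2 v c \<le> det2 v a"
    | "det2 v c \<le> det2 v a \<and> det2 v a \<le> det2 v b" | "det2 v c \<le> det2 v b \<and> det2 v b \<le> det2 v a"
    by linarith
  then show False
    using three_translates[of _ _ _ v] mem abc(2-4) assms by cases metis+
qed

text \<open>Another translate has a point in the closed parallelogram; by emptiness it is a corner,
  which puts it in the class of \<open>x\<close>. If \<open>f\<close> and \<open>g\<close> are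
  parallel, one corner lies between two others.\<close>

lemma no_parallelogram:
  assumes "k \<ge> 2" and V: "x \<in> V" "x + f \<in> V" "x + g \<in> V" "x + f + g \<in> V"
    and L: "f \<in> L" "g \<in> L" and nz: "f \<noteq> 0" "g \<noteq> 0"
  shows False
proof (cases "det2 f g = 0")
  case True
  then obtain c where c: "g = c *\<^sub>R f" using det2_zero_imp_parallel nz(1) by blast
  show False
  proof (cases "c \<ge> 0")
    case True
    have "x + f \<in> convex hull {x, x + f + g}"
      by (rule weighted_mean_in_convex_hull[of x _ "x + f + g" c 1]) (use True in \<open>auto simp: hull_inc c algebra_simps\<close>)
    then have "x + f \<in> {x, x + f + g}" by (rule vertex) (use V V_in_S in auto)
    then show False using nz by auto
  next
    case False
    have "x \<in> convex hull {x + f, x + g}"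
      by (rule weighted_mean_in_convex_hull[of "x + f" _ "x + g" "- c" 1]) (use False in \<open>auto simp: hull_inc c algebra_simps\<close>)
    then have "x \<in> {x + f, x + g}" by (rule vertex) (use V V_in_S in auto)
    then show False using nz by auto
  qed
next
  case False
  obtain i where i: "i \<in> {1..k}" "x - t i \<in> L" using V_in_S[OF V(1)] S_iff by blast
  obtain j where j: "j \<in> {1..k}" "j \<noteq> i"
  proof (cases "i = 1")
    case True
    then show thesis using that[of 2] \<open>k \<ge> 2\<close> by simp
  next
    case False
    then show thesis using that[of 1] \<open>k \<ge> 2\<close> by simp
  qed
  obtain a b where ab: "t j - x = a *\<^sub>R f + b *\<^sub>R g" using det2_nonzero_coordinates[OF False] by blast
  \<comment> \<open>Subtracting integer multiples of \<open>f\<close> and \<open>g\<close> moves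
    \<open>t j\<close> into the parallelogram without leaving its translate.\<close>
  define z where "z = x + frac a *\<^sub>R f + frac b *\<^sub>R g"
  have z: "z = t j + (of_int (- \<lfloor>a\<rfloor>) *\<^sub>R f + of_int (- \<lfloor>b\<rfloor>) *\<^sub>R g)"
  proof -
    have "t j = x + a *\<^sub>R f + b *\<^sub>R g" using ab by (simp add: algebra_simps)
    then show ?thesis by (simp add: z_def frac_def algebra_simps)
  qed
  have zL: "z - t j \<in> L" unfolding z using L by (simp add: add of_int_scale del: of_int_minus)
  then have "z \<in> S" using j(1) S_iff by blast
  let ?H = "convex hull {x, x + f, x + g, x + f + g}"
  have fr: "0 \<le> frac a" "frac a \<le> 1" "0 \<le> frac b" "frac b \<le> 1"
    using frac_lt_1[of a] frac_lt_1[of b] by auto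
  have p: "(1 - frac a) *\<^sub>R x + frac a *\<^sub>R (x + f) \<in> ?H" "(1 - frac a) *\<^sub>R (x + g) + frac a *\<^sub>R (x + f + g) \<in> ?H"
    using fr by (intro convexD convex_convex_hull hull_inc; simp)+
  have "z = (1 - frac b) *\<^sub>R ((1 - frac a) *\<^sub>R x + frac a *\<^sub>R (x + f)) +
      frac b *\<^sub>R ((1 - frac a) *\<^sub>R (x + g) + frac a *\<^sub>R (x + f + g))"
    by (simp add: z_def vec_eq_iff algebra_simps)
  also have "\<dots> \<in> ?H" using fr by (intro convexD convex_convex_hull p) auto
  finally have "z \<in> {x, x + f, x + g, x + f + g}"
    by (rule vertex) (use V \<open>z \<in> S\<close> in auto)
  then have "z - x \<in> {0, f, g, f + g}" by auto
  then have "z - x \<in> L" using zero L add by auto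
  then have "(z - x) + (x - t i) - (z - t j) \<in> L" using i zL by (blast intro: add diff)
  then have "t j - t i \<in> L" by (simp add: algebra_simps)
  then show False using incongruent i j by blast
qed

text \<open>Two chords with congruent directions v, w and midpoints p, q: in the coordinates with
  half-axes v/2, w/2 at p, the point p + w/2 is in the class of the first chord, and it lies in the triangle
  spanned by the first chord and q + w/2 as soon as q - p has coordinates with second at least the first.\<close>

lemma congruent_chords_ordered:
  assumes "k \<ge> 2" and V: "x \<in> V" "x' \<in> V" "y \<in> V" "y' \<in> V"
    and "x - x' \<in> L" "y - y' \<in> L" "x \<noteq> x'" "y \<noteq> y'"
    and u: "u \<in> L" "(x - x') - (y - y') = 2 *\<^sub>R u"
    and ab: "(y + y') - (x + x') = a *\<^sub>R (x - x') + b *\<^sub>R (y - y')" "0 \<le> a" "a \<le> b"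
  shows "x - x' = y - y' \<or> x - x' = - (y - y')"
proof (rule ccontr)
  assume "\<not> ?thesis"
  then have n: "x - x' \<noteq> y - y'" "x - x' \<noteq> - (y - y')" by auto
  define w where "w = y - y'"
  have y': "y' = y - w" and x: "x = x' + w + 2 *\<^sub>R u" using u(2) by (auto simp: w_def algebra_simps)
  have wL: "w \<in> L" using assms by (simp add: w_def)
  define z where "z = x' + (w + u)"
  have "2 *\<^sub>R y = (y + y') - (x + x') + x + x' + w" by (simp add: w_def scaleR_2)
  also have "\<dots> = a *\<^sub>R (w + 2 *\<^sub>R u) + b *\<^sub>R w + 2 *\<^sub>R x' + 2 *\<^sub>R w + 2 *\<^sub>R u"
    unfolding ab(1) by (simp add: x y' scaleR_2)
  finally have "y = (1/2) *\<^sub>R (a *\<^sub>R (w + 2 *\<^sub>R u) + b *\<^sub>R w + 2 *\<^sub>R x' + 2 *\<^sub>R w + 2 *\<^sub>R u)"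
    by (simp add: vec_eq_iff field_simps)
  then have y: "y = x' + w + u + ((a + b) / 2) *\<^sub>R w + a *\<^sub>R u"
    by (simp add: vec_eq_iff field_simps)
  have b: "b \<ge> 0" using ab by simp
  \<comment> \<open>\<open>q\<close> groups two terms of \<open>(2 * b + 2) *\<^sub>R z = (b - a)
    *\<^sub>R x + (a + b) *\<^sub>R x' + 2 *\<^sub>R y\<close>, whose weights are nonnegative
    because \<open>0 \<le> a\<close> and \<open>a \<le> b\<close>.\<close>
  define q where "q = (a + b) *\<^sub>R x' + 2 *\<^sub>R y"
  have q: "(1 / (a + b + 2)) *\<^sub>R q \<in> convex hull {x, x', y}"
    by (rule weighted_mean_in_convex_hull[of x' _ y "a + b" 2]) (use ab b in \<open>auto simp: hull_inc q_def\<close>)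
  have "z \<in> convex hull {x, x', y}"
  proof (rule weighted_mean_in_convex_hull[of x _ "(1 / (a + b + 2)) *\<^sub>R q" "b - a" "a + b + 2"])
    have "(b - a) *\<^sub>R x + q = (b - a + (a + b + 2)) *\<^sub>R z"
      by (simp add: q_def z_def x y vec_eq_iff field_simps)
    then show "(b - a + (a + b + 2)) *\<^sub>R z = (b - a) *\<^sub>R x + (a + b + 2) *\<^sub>R ((1 / (a + b + 2)) *\<^sub>R q)"
      using ab b by simp
  qed (use q ab b in \<open>auto simp: hull_inc\<close>)
  then have "z \<in> {x, x', y}"
    by (rule vertex) (use V V_in_S translate_in_S add wL u in \<open>auto simp: z_def\<close>)
  have wu: "w + u \<noteq> 0"
  proof
    assume "w + u = 0"
    then have "u = - w" by (simp add: eq_neg_iff_add_eq_0 add.commute)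
    then have "x - x' = - w" using x by (simp add: scaleR_2)
    then show False using n(2) by (simp add: w_def)
  qed
  from \<open>z \<in> {x, x', y}\<close> consider "u = 0" | "w + u = 0" | "y = x' + (w + u)"
    by (auto simp: z_def x scaleR_2 algebra_simps)
  then show False
  proof cases
    case 1
    then show False using n u(2) by simp
  next
    case 2
    then show False using wu by simp
  next
    \<comment> \<open>Here the two chords are the diagonals of the parallelogram at
      \<open>x'\<close> spanned by \<open>u\<close> and \<open>w + u\<close>.\<close>
    case 3
    then have "y' = x' + u" "x = x' + u + (w + u)" using y' x by (simp_all add: scaleR_2)
    moreover have "u \<noteq> 0" using n(1) u(2) by auto
    ultimately show False
      using no_parallelogram[of x' u "w + u"] wu V 3 assms(1) u(1) add wL by (simp add: add.assoc)
  qed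
qed

text \<open>Swapping the ends of the first or second chord changes the sign of \<open>a\<close> or
  \<open>b\<close> and preserves congruence modulo twice the lattice, so all sign patterns reduce to
  the nonnegative one.\<close>

lemma congruent_chords_ordered_abs:
  assumes "k \<ge> 2" and V: "x \<in> V" "x' \<in> V" "y \<in> V" "y' \<in> V"
    and L: "x - x' \<in> L" "y - y' \<in> L" and ne: "x \<noteq> x'" "y \<noteq> y'"
    and u: "u \<in> L" "(x - x') - (y - y') = 2 *\<^sub>R u"
    and ab: "(y + y') - (x + x') = a *\<^sub>R (x - x') + b *\<^sub>R (y - y')" "\<bar>a\<bar> \<le> \<bar>b\<bar>"
  shows "x - x' = y - y' \<or> x - x' = - (y - y')"
proof -
  have L': "x' - x \<in> L" "y' - y \<in> L" using minus[OF L(1)] minus[OF L(2)] by auto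
  have uL: "- (u + (y - y')) \<in> L" "u + (y - y') \<in> L" "- u \<in> L"
    by (intro add minus u(1) L(2))+
  have x: "x = x' + (y - y') + 2 *\<^sub>R u" using u(2) by (simp add: algebra_simps)
  have e: "(x' - x) - (y - y') = 2 *\<^sub>R (- (u + (y - y')))" "(x - x') - (y' - y) = 2 *\<^sub>R (u + (y - y'))"
      "(x' - x) - (y' - y) = 2 *\<^sub>R (- u)"
    by (simp_all add: x vec_eq_iff algebra_simps)
  have f: "(y + y') - (x' + x) = (- a) *\<^sub>R (x' - x) + b *\<^sub>R (y - y')"
      "(y' + y) - (x + x') = a *\<^sub>R (x - x') + (- b) *\<^sub>R (y' - y)"
      "(y' + y) - (x' + x) = (- a) *\<^sub>R (x' - x) + (- b) *\<^sub>R (y' - y)"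
    using ab(1) by (simp_all add: vec_eq_iff algebra_simps)
  note core = congruent_chords_ordered[OF assms(1)]
  consider "0 \<le> a" "0 \<le> b" | "a \<le> 0" "0 \<le> b" | "0 \<le> a" "b \<le> 0" | "a \<le> 0" "b \<le> 0" by linarith
  then have "x - x' = y - y' \<or> x - x' = y' - y \<or> x' - x = y - y' \<or> x' - x = y' - y"
  proof cases
    case 1
    then show ?thesis using core[OF V L ne u ab(1)] ab(2) by auto
  next
    case 2
    then show ?thesis
      using core[OF V(2,1,3,4) L'(1) L(2) ne(1)[symmetric] ne(2) uL(1) e(1) f(1)] ab(2) by auto
  next
    case 3
    then show ?thesis
      using core[OF V(1,2,4,3) L(1) L'(2) ne(1) ne(2)[symmetric] uL(2) e(2) f(2)] ab(2) by auto
  next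
    case 4
    then show ?thesis
      using core[OF V(2,1,4,3) L' ne(1)[symmetric] ne(2)[symmetric] uL(3) e(3) f(3)] ab(2) by auto
  qed
  then show ?thesis by (metis minus_diff_eq)
qed

lemma no_short_parallel:
  assumes V: "x \<in> V" "x' \<in> V" and w: "w \<in> L" "w \<noteq> 0" "w = c *\<^sub>R (x - x')" and c: "\<bar>c\<bar> < 1"
  shows False
proof -
  have *: False if w: "w \<in> L" "w \<noteq> 0" "w = c *\<^sub>R (x - x')" and c: "0 < c" "c < 1" for w c
  proof -
    have "x' + w \<in> convex hull {x', x}"
      by (rule weighted_mean_in_convex_hull[of x' _ x "1 - c" c])
        (use c in \<open>auto simp: hull_inc w(3) algebra_simps\<close>)
    then have "x' + w \<in> {x', x}"
      by (rule vertex) (use V V_in_S translate_in_S w in auto)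
    then have "w = x - x'" using w(2) by auto
    then have "(1 - c) *\<^sub>R (x - x') = 0" using w(3) by (simp add: scaleR_left_diff_distrib)
    then show False using c w(2) \<open>w = x - x'\<close> by auto
  qed
  show False
  proof (cases "c > 0")
    case True
    then show False using *[OF w] c by auto
  next
    case False
    moreover have "c \<noteq> 0" using w by auto
    ultimately show False using *[of "- w" "- c"] w c minus by auto
  qed
qed

text \<open>Parallel chords have length ratio 1, since neither can be a shorter lattice vector along
  the other. Otherwise the difference of the doubled midpoints has coordinates \<open>a\<close>,
  \<open>b\<close> in the two directions, and exchanging the chords if necessary makes the first the
  smaller in absolute value.\<close>

lemma congruent_chords:
  assumes "k \<ge> 2" and V: "x \<in> V" "x' \<in> V" "y \<in> V" "y' \<in> V"
    and L: "x - x' \<in> L" "y - y' \<in> L" and ne: "x \<noteq> x'" "y \<noteq> y'"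
    and par: "par (x - x') = par (y - y')"
  shows "x - x' = y - y' \<or> x - x' = - (y - y')"
proof (cases "det2 (x - x') (y - y') = 0")
  case True
  then obtain c where c: "y - y' = c *\<^sub>R (x - x')"
    using det2_zero_imp_parallel ne by (metis right_minus_eq)
  have "c \<noteq> 0" using c ne by auto
  have "\<not> \<bar>c\<bar> < 1" using no_short_parallel[OF V(1,2) L(2) _ c] ne by auto
  moreover have "\<not> \<bar>c\<bar> > 1"
  proof
    assume "\<bar>c\<bar> > 1"
    then have "\<bar>1 / c\<bar> < 1" by simp
    moreover have "x - x' = (1 / c) *\<^sub>R (y - y')" using c \<open>c \<noteq> 0\<close> by simp
    ultimately show False using no_short_parallel[OF V(3,4) L(1), of "1 / c"] ne \<open>c \<noteq> 0\<close> by auto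
  qed
  ultimately have "\<bar>c\<bar> = 1" by simp
  then have "c = 1 \<or> c = - 1" by linarith
  then show ?thesis using c by auto
next
  case False
  obtain u where u: "u \<in> L" "(x - x') - (y - y') = 2 *\<^sub>R u" using parity[OF L par] by blast
  have u': "- u \<in> L" "(y - y') - (x - x') = 2 *\<^sub>R (- u)"
    using u minus by (auto simp: algebra_simps)
  obtain a b where ab: "(y + y') - (x + x') = a *\<^sub>R (x - x') + b *\<^sub>R (y - y')"
    using det2_nonzero_coordinates[OF False] by blast
  have ab': "(x + x') - (y + y') = (- b) *\<^sub>R (y - y') + (- a) *\<^sub>R (x - x')"
    using ab by (simp add: vec_eq_iff algebra_simps)
  show ?thesis
  proof (cases "\<bar>a\<bar> \<le> \<bar>b\<bar>")
    case True
    show ?thesis by (rule congruent_chords_ordered_abs[OF assms(1) V L ne u ab True])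
  next
    case False
    then have "\<bar>- b\<bar> \<le> \<bar>- a\<bar>" by simp
    then have "y - y' = x - x' \<or> y - y' = - (x - x')"
      by (rule congruent_chords_ordered_abs[OF assms(1) V(3,4,1,2) L(2,1) ne(2,1) u' ab'])
    then show ?thesis by (metis minus_diff_eq)
  qed
qed

section \<open>Counting chords and vertices\<close>

lemma finite_V: "finite V"
  using polygon by (simp add: empty_polytope_def)

text \<open>Chords are counted as ordered pairs, so 12 stands for six. In each of the three nonzero
  parity classes all differences are \<open>v\<close> or \<open>- v\<close>, and each of the two
  occurs at most twice.\<close>

lemma card_chords_le:
  assumes "k \<ge> 2"
  shows "card {(x, y) \<in> V \<times> V. x \<noteq> y \<and> x - y \<in> L} \<le> 12"
proof -
  define Q where "Q c = {(x, y) \<in> V \<times> V. x \<noteq> y \<and> x - y \<in> L \<and> par (x - y) = c}" for c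
  have "card (Q c) \<le> 4" for c
  proof (cases "Q c = {}")
    case False
    then obtain x y where xy: "(x, y) \<in> Q c" by auto
    define v where "v = x - y"
    define W where "W v = {z \<in> V. z + v \<in> V}" for v
    have "Q c \<subseteq> (\<lambda>z. (z + v, z)) ` W v \<union> (\<lambda>z. (z + (- v), z)) ` W (- v)"
    proof
      fix p assume p: "p \<in> Q c"
      obtain x' y' where p': "p = (x', y')" by (cases p)
      have "x' - y' = v \<or> x' - y' = - v"
        unfolding v_def using p xy by (intro congruent_chords assms) (auto simp: p' Q_def)
      then have "x' = y' + v \<or> x' = y' + - v" by (auto simp: algebra_simps)
      then show "p \<in> (\<lambda>z. (z + v, z)) ` W v \<union> (\<lambda>z. (z + (- v), z)) ` W (- v)"
        using p by (auto simp: p' Q_def W_def)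
    qed
    moreover have "finite (W v)" for v by (simp add: W_def finite_V)
    ultimately have "card (Q c) \<le> card ((\<lambda>z. (z + v, z)) ` W v \<union> (\<lambda>z. (z + (- v), z)) ` W (- v))"
      by (intro card_mono) auto
    also have "\<dots> \<le> card (W v) + card (W (- v))"
      by (meson add_mono card_Un_le card_image_le order_trans \<open>\<And>v. finite (W v)\<close>)
    also have "v \<noteq> 0" using xy by (auto simp: Q_def v_def)
    then have "card (W v) + card (W (- v)) \<le> 4"
      using at_most_two_translates[of v] at_most_two_translates[of "- v"] by (simp add: W_def)
    finally show ?thesis .
  qed simp
  moreover have "card (UNIV - {par 0}) = 3"
  proof -
    have "card (UNIV :: (bool \<times> bool) set) = 4"
      by (simp add: card_cartesian_product flip: UNIV_Times_UNIV)
    then show ?thesis by (subst card_Diff_singleton) simp_all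
  qed
  ultimately have "(\<Sum>c\<in>UNIV - {par 0}. card (Q c)) \<le> 3 * 4"
    using sum_bounded_above[of "UNIV - {par 0}" "\<lambda>c. card (Q c)" 4] by simp
  moreover have "{(x, y) \<in> V \<times> V. x \<noteq> y \<and> x - y \<in> L} \<subseteq> (\<Union>c\<in>UNIV - {par 0}. Q c)"
    using parity_nonzero by (auto simp: Q_def)
  then have "card {(x, y) \<in> V \<times> V. x \<noteq> y \<and> x - y \<in> L} \<le> card (\<Union>c\<in>UNIV - {par 0}. Q c)"
    by (rule card_mono[rotated]) (auto simp: Q_def intro: finite_subset[OF _ finite_cartesian_product[OF finite_V finite_V]])
  moreover have "card (\<Union>c\<in>UNIV - {par 0}. Q c) \<le> (\<Sum>c\<in>UNIV - {par 0}. card (Q c))"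
    by (rule card_UN_le) simp
  ultimately show ?thesis by linarith
qed

lemma card_V_le:
  assumes "k \<ge> 2"
  shows "card V \<le> k + 6" "2 * card V \<le> 3 * k + 6"
proof -
  define W where "W i = {x \<in> V. x - t i \<in> L}" for i
  define P where "P i = W i \<times> W i - (\<lambda>x. (x, x)) ` W i" for i
  define n where "n i = card (W i)" for i
  have finW: "finite (W i)" for i by (simp add: W_def finite_V)
  have disj: "W i \<inter> W j = {}" if "i \<in> {1..k}" "j \<in> {1..k}" "i \<noteq> j" for i j
  proof (rule ccontr)
    assume "W i \<inter> W j \<noteq> {}"
    then obtain x where "x - t i \<in> L" "x - t j \<in> L" by (auto simp: W_def)
    then have "(x - t j) - (x - t i) \<in> L" by (rule diff[rotated])
    then show False using incongruent[OF that] by (simp add: algebra_simps)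
  qed
  have "V = (\<Union>i\<in>{1..k}. W i)" using V_in_S S_iff by (auto simp: W_def)
  then have cardV: "card V = (\<Sum>i=1..k. n i)"
    unfolding n_def using card_UN_disjoint[of "{1..k}" W] finW disj by auto
  have "card (P i) = n i * n i - n i" for i
    unfolding P_def n_def using finW
    by (subst card_Diff_subset) (auto simp: card_image inj_on_def card_cartesian_product)
  moreover have "P i \<inter> P j = {}" if "i \<in> {1..k}" "j \<in> {1..k}" "i \<noteq> j" for i j
    using disj[OF that] by (auto simp: P_def)
  then have "card (\<Union>i\<in>{1..k}. P i) = (\<Sum>i=1..k. card (P i))"
    by (intro card_UN_disjoint) (auto simp: P_def finW)
  moreover have "(\<Union>i\<in>{1..k}. P i) \<subseteq> {(x, y) \<in> V \<times> V. x \<noteq> y \<and> x - y \<in> L}"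
  proof
    fix p assume "p \<in> (\<Union>i\<in>{1..k}. P i)"
    then obtain i x y where p: "p = (x, y)" "x \<in> V" "y \<in> V" "x \<noteq> y" "x - t i \<in> L" "y - t i \<in> L"
      by (auto simp: P_def W_def)
    then have "(x - t i) - (y - t i) \<in> L" by (blast intro: diff)
    then show "p \<in> {(x, y) \<in> V \<times> V. x \<noteq> y \<and> x - y \<in> L}" using p by simp
  qed
  then have "card (\<Union>i\<in>{1..k}. P i) \<le> card {(x, y) \<in> V \<times> V. x \<noteq> y \<and> x - y \<in> L}"
    by (rule card_mono[rotated]) (auto intro: finite_subset[OF _ finite_cartesian_product[OF finite_V finite_V]])
  ultimately have sum: "(\<Sum>i=1..k. n i * n i - n i) \<le> 12"
    using card_chords_le[OF assms] by simp
  \<comment> \<open>These say (n - 1) (n - 2) >= 0 and (n - 2) (n - 3) >= 0; the constants stand on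
    the right to avoid truncated subtraction.\<close>
  have quad: "2 * n \<le> 2 + (n * n - n)" "4 * n \<le> 6 + (n * n - n)" for n :: nat
  proof -
    consider "n = 0" | "n = 1" | "n = 2" | "n = 3" | "n = 4" | "5 \<le> n" by linarith
    then have "2 * n \<le> 2 + (n * n - n) \<and> 4 * n \<le> 6 + (n * n - n)"
    proof cases
      case 6
      then have "5 * n \<le> n * n" by simp
      then show ?thesis by linarith
    qed auto
    then show "2 * n \<le> 2 + (n * n - n)" "4 * n \<le> 6 + (n * n - n)" by auto
  qed
  have "2 * card V \<le> (\<Sum>i=1..k. 2 + (n i * n i - n i))"
    unfolding cardV sum_distrib_left by (intro sum_mono quad)
  also have "\<dots> = 2 * k + (\<Sum>i=1..k. n i * n i - n i)" by (subst sum.distrib) simp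
  finally show "card V \<le> k + 6" using sum by simp
  have "4 * card V \<le> (\<Sum>i=1..k. 6 + (n i * n i - n i))"
    unfolding cardV sum_distrib_left by (intro sum_mono quad)
  also have "\<dots> = 6 * k + (\<Sum>i=1..k. n i * n i - n i)" by (subst sum.distrib) simp
  finally show "2 * card V \<le> 3 * k + 6" using sum by simp
qed

text \<open>The parity label is injective on the vertices, by the midpoint argument.\<close>

lemma card_V_le_4:
  assumes "k = 1"
  shows "card V \<le> 4"
proof -
  have "x - t 1 \<in> L" if "x \<in> V" for x using V_in_S[OF that] S_iff assms by auto
  then have "inj_on (\<lambda>x. par (x - t 1)) V" by (intro inj_onI same_parity_distinct) auto
  then have "card V \<le> card (UNIV :: (bool \<times> bool) set)" by (rule card_inj_on_le) auto
  then show ?thesis by (simp add: card_cartesian_product flip: UNIV_Times_UNIV)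
qed

end

text \<open>For k from 2 to 6 the second bound is the smaller one, and at 6 both give 12; the
  division rounds down at 3 and 5.\<close>

definition max_helly :: "nat \<Rightarrow> nat" where
  "max_helly k = (if k = 1 then 4 else min (k + 6) ((3 * k + 6) div 2))"

lemma crystal_helly_number_le:
  fixes S :: "(real ^ 2) set"
  assumes "crystal k S" "k \<ge> 1"
  shows "helly_number S \<le> enat (max_helly k)"
proof (rule helly_number_le)
  obtain L t where L: "full_rank_lattice L"
      and t: "\<And>i j. i \<in> {1..k} \<Longrightarrow> j \<in> {1..k} \<Longrightarrow> i \<noteq> j \<Longrightarrow> t i - t j \<notin> L"
      and S: "S = (\<Union>i\<in>{1..k}. (\<lambda>x. x + t i) ` L)"
    using assms unfolding crystal_def by blast
  obtain par where par: "planar_lattice L par" using full_rank_lattice_planar[OF L] by blast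
  show "helly_property S (max_helly k)"
  proof (rule helly_property_if_empty_polytopes_small)
    fix X :: "(real ^ 2) set" assume "finite X"
    then have "bounded (convex hull X)" by (simp add: bounded_convex_hull finite_imp_bounded)
    then have "finite ((\<lambda>x. x + t i) ` (L \<inter> (\<lambda>x. x - t i) ` (convex hull X)))" for i
      by (intro finite_imageI planar_lattice.discrete[OF par] bounded_translation_minus)
    moreover have "S \<inter> convex hull X \<subseteq> (\<Union>i\<in>{1..k}. (\<lambda>x. x + t i) ` (L \<inter> (\<lambda>x. x - t i) ` (convex hull X)))"
      unfolding S by (force simp: image_iff)
    ultimately show "finite (S \<inter> convex hull X)" by (meson finite_UN finite_atLeastAtMost finite_subset)
  next
    fix V assume "empty_polytope S V"
    then interpret empty_crystal_polygon L par k t S V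
      using par t S by (intro empty_crystal_polygon.intro empty_crystal_polygon_axioms.intro)
    show "card V \<le> max_helly k"
      using card_V_le card_V_le_4 assms(2) by (cases "k = 1") (auto simp: max_helly_def)
  qed
  show "1 \<le> max_helly k" using assms(2) by (auto simp: max_helly_def)
qed

section \<open>Extremal crystals\<close>

definition pt :: "real \<Rightarrow> real \<Rightarrow> real ^ 2" where
  "pt x y = vector [x, y]"

lemma pt_nth [simp]: "pt x y $ 1 = x" "pt x y $ 2 = y"
  by (simp_all add: pt_def)

lemma pt_eq_iff [simp]: "pt x y = pt x' y' \<longleftrightarrow> x = x' \<and> y = y'"
  by (auto simp: vec_eq_iff forall_2)

lemma pt_add: "pt x y + pt x' y' = pt (x + x') (y + y')"
  by (simp add: vec_eq_iff forall_2)

lemma pt_diff: "pt x y - pt x' y' = pt (x - x') (y - y')"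
  by (simp add: vec_eq_iff forall_2)

lemma pt_collapse: "pt (z $ 1) (z $ 2) = z"
  by (simp add: vec_eq_iff forall_2)

lemma inner_pt: "pt a b \<bullet> z = a * z $ 1 + b * z $ 2"
  by (simp add: inner_vec_def sum_2)

definition ipt :: "int \<times> int \<Rightarrow> real ^ 2" where
  "ipt p = pt (of_int (fst p)) (of_int (snd p))"

lemma inj_ipt: "inj ipt"
  by (auto simp: inj_def ipt_def prod_eq_iff)

text \<open>All examples use a scaled square grid; where hexagonal geometry is wanted, it sits in
  the quadratic form. Integral translates are then residue classes modulo \<open>N\<close>, and
  checks become divisibility of integers.\<close>

definition grid :: "int \<Rightarrow> (real ^ 2) set" where
  "grid N = {pt (of_int (N * i)) (of_int (N * j)) | i j. True}"

definition grid_translates :: "int \<Rightarrow> (real ^ 2) set \<Rightarrow> (real ^ 2) set" where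
  "grid_translates N R = (\<Union>r\<in>R. (\<lambda>x. x + r) ` grid N)"

lemma full_rank_lattice_grid:
  assumes "N \<noteq> 0"
  shows "full_rank_lattice (grid N)"
  unfolding full_rank_lattice_def
proof (intro exI conjI)
  let ?N = "of_int N :: real"
  let ?b = "pt ?N 0" and ?c = "pt 0 ?N"
  have bc: "?b \<noteq> ?c" using assms by simp
  show "independent {?b, ?c}"
  proof (rule pairwise_orthogonal_independent)
    show "pairwise orthogonal {?b, ?c}" by (auto simp: pairwise_def orthogonal_def inner_pt)
    show "0 \<notin> {?b, ?c}" using assms by (auto simp: vec_eq_iff forall_2)
  qed
  have "z \<in> span {?b, ?c}" for z
  proof -
    have "z = (z $ 1 / ?N) *\<^sub>R ?b + (z $ 2 / ?N) *\<^sub>R ?c"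
      using assms by (simp add: vec_eq_iff forall_2)
    also have "\<dots> \<in> span {?b, ?c}"
      by (intro span_add span_scale span_base) auto
    finally show ?thesis .
  qed
  then show "span {?b, ?c} = UNIV" by auto
  have "(\<Sum>x\<in>{?b, ?c}. of_int (f x) *\<^sub>R x) = pt (of_int (N * f ?b)) (of_int (N * f ?c))" for f :: "real ^ 2 \<Rightarrow> int"
    using bc by (simp add: vec_eq_iff forall_2)
  moreover have "\<exists>f :: real ^ 2 \<Rightarrow> int. f ?b = i \<and> f ?c = j" for i j
    using bc by (intro exI[of _ "\<lambda>x. if x = ?b then i else j"]) auto
  ultimately have "(\<exists>f :: real ^ 2 \<Rightarrow> int. v = (\<Sum>x\<in>{?b, ?c}. of_int (f x) *\<^sub>R x)) \<longleftrightarrow>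
      (\<exists>i j. v = pt (of_int (N * i)) (of_int (N * j)))" for v
    by (simp only:) (metis (no_types, lifting))
  then show "grid N = {\<Sum>x\<in>{?b, ?c}. of_int (f x) *\<^sub>R x | f. True}"
    unfolding grid_def by simp
qed

lemma crystal_grid_translates:
  assumes "N \<noteq> 0" "finite R" and "\<And>r s. r \<in> R \<Longrightarrow> s \<in> R \<Longrightarrow> r - s \<in> grid N \<Longrightarrow> r = s"
  shows "crystal (card R) (grid_translates N R)"
proof -
  obtain t where t: "bij_betw t {1..card R} R"
    using ex_bij_betw_nat_finite_1[OF assms(2)] by blast
  show ?thesis
    unfolding crystal_def
  proof (intro exI conjI)
    show "full_rank_lattice (grid N)" by (rule full_rank_lattice_grid[OF assms(1)])
    show "\<forall>i\<in>{1..card R}. \<forall>j\<in>{1..card R}. i \<noteq> j \<longrightarrow> t i - t j \<notin> grid N"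
      using t assms(3) by (metis bij_betwE bij_betw_imp_inj_on inj_onD)
    show "grid_translates N R = (\<Union>i\<in>{1..card R}. (\<lambda>x. x + t i) ` grid N)"
      unfolding grid_translates_def
      by (subst (1) bij_betw_imp_surj_on[OF t, symmetric]) (simp add: image_image)
  qed
qed

lemma ipt_diff_in_grid:
  "ipt p - ipt q \<in> grid N \<longleftrightarrow> N dvd fst p - fst q \<and> N dvd snd p - snd q"
proof -
  have "ipt p - ipt q = pt (of_int (fst p - fst q)) (of_int (snd p - snd q))"
    by (simp add: ipt_def pt_diff)
  then show ?thesis
    unfolding grid_def by (auto simp only: pt_eq_iff of_int_eq_iff dvd_def mem_Collect_eq)
qed

lemma grid_translates_ipt:
  "z \<in> grid_translates N (ipt ` R) \<longleftrightarrow> (\<exists>p r. r \<in> R \<and> z = ipt p \<and> N dvd fst p - fst r \<and> N dvd snd p - snd r)"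
proof
  assume "z \<in> grid_translates N (ipt ` R)"
  then obtain i j r where r: "r \<in> R" "z = pt (of_int (N * i)) (of_int (N * j)) + ipt r"
    by (auto simp: grid_translates_def grid_def)
  then have "z = ipt (N * i + fst r, N * j + snd r)" by (simp add: ipt_def pt_add)
  then show "\<exists>p r. r \<in> R \<and> z = ipt p \<and> N dvd fst p - fst r \<and> N dvd snd p - snd r"
    using r(1) by (intro exI[of _ "(N * i + fst r, N * j + snd r)"] exI[of _ r]) simp
next
  assume "\<exists>p r. r \<in> R \<and> z = ipt p \<and> N dvd fst p - fst r \<and> N dvd snd p - snd r"
  then obtain p r where r: "r \<in> R" "z = ipt p" "z - ipt r \<in> grid N" using ipt_diff_in_grid by metis
  have "z = (z - ipt r) + ipt r" by simp
  then show "z \<in> grid_translates N (ipt ` R)" using r unfolding grid_translates_def by blast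
qed

lemma empty_polytope_if_exposed:
  fixes S :: "'a::real_inner set"
  assumes "finite V" "V \<subseteq> S" "S \<inter> convex hull V \<subseteq> V"
    and exposed: "\<And>v. v \<in> V \<Longrightarrow> \<exists>a. \<forall>w\<in>V - {v}. a \<bullet> w < a \<bullet> v"
  shows "empty_polytope S V"
  unfolding empty_polytope_def
proof (intro conjI assms(1-3) ballI)
  fix v assume "v \<in> V"
  then obtain a where a: "\<forall>w\<in>V - {v}. a \<bullet> w < a \<bullet> v" using exposed by blast
  then have "convex hull (V - {v}) \<subseteq> {w. a \<bullet> w < a \<bullet> v}"
    by (intro hull_minimal convex_halfspace_lt) auto
  then show "v \<notin> convex hull (V - {v})" by auto
qed

text \<open>Used to discard a translate: the example for three of them is cut out of the one for
  four.\<close>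

lemma empty_polytope_restrict:
  assumes "empty_polytope S V" "S' \<subseteq> S"
  shows "empty_polytope S' (V \<inter> S')"
  unfolding empty_polytope_def
proof (intro conjI ballI)
  show "finite (V \<inter> S')" using assms by (auto simp: empty_polytope_def)
  have "convex hull (V \<inter> S') \<subseteq> convex hull V" by (intro hull_mono) auto
  then show "S' \<inter> convex hull (V \<inter> S') \<subseteq> V \<inter> S'" using assms by (auto simp: empty_polytope_def)
  fix v assume "v \<in> V \<inter> S'"
  moreover have "convex hull (V \<inter> S' - {v}) \<subseteq> convex hull (V - {v})" by (intro hull_mono) auto
  ultimately show "v \<notin> convex hull (V \<inter> S' - {v})" using assms by (auto simp: empty_polytope_def)
qed auto

text \<open>Positive definite for \<open>\<bar>c\<bar> < 2\<close>: \<open>c = 0\<close> is the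
  squared Euclidean norm, \<open>c = 1\<close> the norm form of the hexagonal lattice. The circle of
  the overview appears as a level ellipse.\<close>

definition qform :: "real \<Rightarrow> real ^ 2 \<Rightarrow> real" where
  "qform c z = (z $ 1)\<^sup>2 + c * z $ 1 * z $ 2 + (z $ 2)\<^sup>2"

lemma qform_pos:
  assumes "\<bar>c\<bar> < 2" "z \<noteq> 0"
  shows "0 < qform c z"
proof -
  have "4 * qform c z = (2 * z $ 1 + c * z $ 2)\<^sup>2 + (4 - c\<^sup>2) * (z $ 2)\<^sup>2"
    by (simp add: qform_def power2_eq_square algebra_simps)
  moreover have "c\<^sup>2 < 4" using assms(1) abs_square_less_1[of "c / 2"] by (simp add: power_divide)
  moreover have "z $ 2 = 0 \<longrightarrow> z $ 1 \<noteq> 0" using assms(2) by (auto simp: vec_eq_iff forall_2)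
  ultimately have "0 < 4 * qform c z"
    by (cases "z $ 2 = 0") (auto intro: add_nonneg_pos)
  then show ?thesis by simp
qed

lemma empty_polytope_on_ellipse:
  assumes c: "\<bar>c\<bar> < 2" and V: "finite V" "V \<subseteq> S"
    and on: "\<And>v. v \<in> V \<Longrightarrow> qform c v = \<rho>"
    and inside: "\<And>z. z \<in> S \<Longrightarrow> qform c z \<le> \<rho> \<Longrightarrow> z \<in> V"
  shows "empty_polytope S V"
proof (rule empty_polytope_if_exposed[OF V])
  \<comment> \<open>\<open>a z\<close> is the gradient of the form at \<open>z\<close>. The
    polarisation identity below bounds the form on the hull by \<open>\<rho>\<close> and, taken at a
    vertex, exposes that vertex.\<close>
  define a where "a z = pt (2 * z $ 1 + c * z $ 2) (c * z $ 1 + 2 * z $ 2)" for z :: "real ^ 2"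
  have a: "a z \<bullet> w = qform c z + qform c w - qform c (z - w)" for z w
    by (simp add: a_def inner_pt qform_def power2_eq_square algebra_simps)
  show "S \<inter> convex hull V \<subseteq> V"
  proof
    fix z assume z: "z \<in> S \<inter> convex hull V"
    have "qform c v \<ge> 0" for v using qform_pos[OF c, of v] by (cases "v = 0") (auto simp: qform_def)
    then have "convex hull V \<subseteq> {w. a z \<bullet> w \<le> qform c z + \<rho>}"
      by (intro hull_minimal convex_halfspace_le) (auto simp: a on)
    then have "a z \<bullet> z \<le> qform c z + \<rho>" using z by auto
    then show "z \<in> V" using inside z by (auto simp: a qform_def)
  qed
  fix v assume v: "v \<in> V"
  have "a v \<bullet> w < a v \<bullet> v" if "w \<in> V - {v}" for w
    using that on v qform_pos[OF c, of "v - w"] by (auto simp: a) (simp add: qform_def)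
  then show "\<exists>a. \<forall>w\<in>V - {v}. a \<bullet> w < a \<bullet> v" by blast
qed

lemma qform_ipt: "qform (of_int c) (ipt (x, y)) = of_int (x * x + c * x * y + y * y)"
  by (simp add: qform_def ipt_def power2_eq_square)

lemma qform_1_ipt: "qform 1 (ipt (x, y)) = of_int (x * x + x * y + y * y)"
  using qform_ipt[of 1 x y] by (simp only: of_int_1 mult_1)

lemma int_abs_le_if_square_le:
  fixes x :: int
  assumes "x * x \<le> n" "n < (m + 1) * (m + 1)" "0 \<le> m"
  shows "- m \<le> x \<and> x \<le> m"
proof (rule ccontr)
  assume "\<not> ?thesis"
  then have "m + 1 \<le> \<bar>x\<bar>" by linarith
  then have "(m + 1) * (m + 1) \<le> \<bar>x\<bar> * \<bar>x\<bar>" using assms(3) by (intro mult_mono) auto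
  then show False using assms by simp
qed

text \<open>From 4 (x^2 + x y + y^2) = 3 x^2 + (x + 2 y)^2 and symmetry; it confines each later
  search to a box of integers.\<close>

lemma eisenstein_norm_bound:
  fixes x y n :: int
  assumes "x * x + x * y + y * y \<le> n" "4 * n < 3 * (m + 1) * (m + 1)" "0 \<le> m"
  shows "- m \<le> x \<and> x \<le> m \<and> - m \<le> y \<and> y \<le> m"
proof -
  have *: "- m \<le> x \<and> x \<le> m" if "x * x + x * y + y * y \<le> n" for x y :: int
  proof (rule ccontr)
    assume "\<not> ?thesis"
    then have "m + 1 \<le> \<bar>x\<bar>" by linarith
    then have "(m + 1) * (m + 1) \<le> \<bar>x\<bar> * \<bar>x\<bar>" using assms(3) by (intro mult_mono) auto
    moreover have "4 * (x * x + x * y + y * y) = 3 * (x * x) + (x + 2 * y) * (x + 2 * y)"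
      by (simp add: algebra_simps)
    moreover have "0 \<le> (x + 2 * y) * (x + 2 * y)" by simp
    ultimately show False using assms that by (simp add: mult.assoc)
  qed
  have "y * y + y * x + x * x \<le> n" using assms(1) by (simp add: algebra_simps)
  then show ?thesis using *[of x y] *[of y x] assms(1) by blast
qed

subsection \<open>Vertices on an ellipse\<close>

text \<open>Reduces an example to integer arithmetic: \<open>R\<close> represents the translates,
  \<open>V\<close> lists their points on the ellipse, and \<open>inside\<close> says that the
  ellipse encloses no others.\<close>

lemma integer_ellipse_example:
  fixes N c n :: int and R V :: "(int \<times> int) set"
  assumes c: "\<bar>c\<bar> < 2" and N: "N \<noteq> 0" and fin: "finite R" "finite V"
    and R: "\<And>p r. p \<in> R \<Longrightarrow> r \<in> R \<Longrightarrow> N dvd fst p - fst r \<Longrightarrow> N dvd snd p - snd r \<Longrightarrow> p = r"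
    and V: "\<And>x y. (x, y) \<in> V \<Longrightarrow> x * x + c * x * y + y * y = n \<and> (\<exists>r\<in>R. N dvd x - fst r \<and> N dvd y - snd r)"
    and inside: "\<And>x y r. r \<in> R \<Longrightarrow> N dvd x - fst r \<Longrightarrow> N dvd y - snd r \<Longrightarrow> x * x + c * x * y + y * y \<le> n \<Longrightarrow> (x, y) \<in> V"
  shows "\<exists>S :: (real ^ 2) set. crystal (card R) S \<and> enat (card V) \<le> helly_number S"
proof (intro exI conjI)
  let ?S = "grid_translates N (ipt ` R)"
  have card: "card (ipt ` A) = card A" for A
    using inj_ipt by (metis card_image inj_on_subset subset_UNIV)
  have "crystal (card (ipt ` R)) ?S"
  proof (rule crystal_grid_translates[OF N])
    fix a b assume "a \<in> ipt ` R" "b \<in> ipt ` R" "a - b \<in> grid N"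
    then obtain p q where "p \<in> R" "q \<in> R" "a = ipt p" "b = ipt q" "ipt p - ipt q \<in> grid N" by auto
    then show "a = b" using R[of p q] by (simp add: ipt_diff_in_grid)
  qed (use fin in simp)
  then show "crystal (card R) ?S" by (simp add: card)
  have "empty_polytope ?S (ipt ` V)"
  proof (rule empty_polytope_on_ellipse[of "of_int c" _ _ "of_int n"])
    show "\<bar>of_int c :: real\<bar> < 2" using c by linarith
    show "finite (ipt ` V)" using fin by simp
    show "ipt ` V \<subseteq> ?S"
    proof safe
      fix x y assume "(x, y) \<in> V"
      then obtain r where "r \<in> R" "N dvd x - fst r" "N dvd y - snd r" using V by blast
      then show "ipt (x, y) \<in> ?S" unfolding grid_translates_ipt by (metis fst_conv snd_conv)
    qed
  next
    fix v assume "v \<in> ipt ` V"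
    then obtain x y where "v = ipt (x, y)" "(x, y) \<in> V" by auto
    then show "qform (of_int c) v = of_int n" using V[of x y] by (simp only: qform_ipt)
  next
    fix z assume z: "z \<in> ?S" "qform (of_int c) z \<le> of_int n"
    then obtain x y r where "r \<in> R" "z = ipt (x, y)" "N dvd x - fst r" "N dvd y - snd r"
      unfolding grid_translates_ipt by auto
    then show "z \<in> ipt ` V"
      using z(2) inside[of r x y] by (simp only: qform_ipt of_int_le_iff) blast
  qed
  from helly_number_ge[OF this] show "enat (card V) \<le> helly_number ?S" by (simp add: card)
qed

text \<open>The square cell of a translate of 2 Z^2, shifted to be centred at the origin.\<close>

lemma crystal_1_example:
  "\<exists>S :: (real ^ 2) set. crystal 1 S \<and> enat 4 \<le> helly_number S"
proof -
  let ?R = "{(1, 1)} :: (int \<times> int) set" and ?V = "{1, -1} \<times> {1, -1} :: (int \<times> int) set"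
  have "\<exists>S :: (real ^ 2) set. crystal (card ?R) S \<and> enat (card ?V) \<le> helly_number S"
  proof (rule integer_ellipse_example[where N = 2 and c = 0 and n = 2])
    fix x y :: int and r
    assume "r \<in> ?R" "2 dvd x - fst r" "2 dvd y - snd r" and le: "x * x + 0 * x * y + y * y \<le> 2"
    then have "odd x" "odd y" by auto
    have "x * x \<le> 2" "y * y \<le> 2" using le zero_le_square[of x] zero_le_square[of y] by linarith+
    then have "- 1 \<le> x \<and> x \<le> 1" "- 1 \<le> y \<and> y \<le> 1" using int_abs_le_if_square_le[of _ 2 1] by auto
    then have "x \<in> {-1, 0, 1}" "y \<in> {-1, 0, 1}" by auto
    then show "(x, y) \<in> ?V" using \<open>odd x\<close> \<open>odd y\<close> by auto
  qed auto
  moreover have "card ?R = 1" "card ?V = 4" by simp_all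
  ultimately show ?thesis by (simp only:)
qed

text \<open>For \<open>c = 1\<close> the two translates are the deep holes of 3 Z^2, at squared
  covering radius 3. Their union is a honeycomb, whose hexagon around the origin has three vertices
  in each translate.\<close>

lemma crystal_2_example:
  "\<exists>S :: (real ^ 2) set. crystal 2 S \<and> enat 6 \<le> helly_number S"
proof -
  let ?R = "{(1, 1), (- 1, - 1)} :: (int \<times> int) set"
    and ?V = "{(1, 1), (- 2, 1), (1, - 2), (- 1, - 1), (2, - 1), (- 1, 2)} :: (int \<times> int) set"
  have "\<exists>S :: (real ^ 2) set. crystal (card ?R) S \<and> enat (card ?V) \<le> helly_number S"
  proof (rule integer_ellipse_example[where N = 3 and c = 1 and n = 3])
    fix x y :: int and r
    assume r: "r \<in> ?R" "3 dvd x - fst r" "3 dvd y - snd r" and le: "x * x + 1 * x * y + y * y \<le> 3"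
    then have "- 2 \<le> x \<and> x \<le> 2 \<and> - 2 \<le> y \<and> y \<le> 2"
      using eisenstein_norm_bound[of x y 3 2] by simp
    then have "x \<in> {-2, -1, 0, 1, 2}" "y \<in> {-2, -1, 0, 1, 2}" by auto
    then show "(x, y) \<in> ?V" using r le by (elim insertE emptyE) simp_all
  qed auto
  moreover have "card ?R = 2" "card ?V = 6" by simp_all
  ultimately show ?thesis by (simp only:)
qed

text \<open>The form x^2 + x y + y^2 turns the square grid 5 Z^2 into a hexagonal lattice with squared covering
  radius 25/3 > 7. The points of norm less than 7 occupy 19 of the 25 classes mod 5; the other six contain
  two points of norm 7 each.\<close>

definition hexagonal_classes :: "(int \<times> int) set" where
  "hexagonal_classes = {(2, 1), (3, - 1), (1, 2), (- 1, 3), (2, - 3), (3, - 2)}"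

definition norm_7_points :: "(int \<times> int) set" where
  "norm_7_points = {(2, 1), (- 3, 1), (3, - 1), (- 2, - 1), (1, 2), (1, - 3), (- 1, 3), (- 1, - 2),
     (2, - 3), (- 3, 2), (3, - 2), (- 2, 3)}"

lemma norm_7_points:
  assumes "(x, y) \<in> norm_7_points"
  shows "x * x + x * y + y * y = 7"
  using assms unfolding norm_7_points_def by (elim insertE emptyE) simp_all

lemma norm_7_points_class:
  assumes "(x, y) \<in> norm_7_points"
  shows "\<exists>r\<in>hexagonal_classes. 5 dvd x - fst r \<and> 5 dvd y - snd r"
  using assms unfolding norm_7_points_def hexagonal_classes_def by (elim insertE emptyE) simp_all

lemma norm_le_7_in_hexagonal_class:
  fixes x y :: int
  assumes r: "r \<in> hexagonal_classes" "5 dvd x - fst r" "5 dvd y - snd r" and le: "x * x + x * y + y * y \<le> 7"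
  shows "(x, y) \<in> norm_7_points"
proof -
  have "- 3 \<le> x \<and> x \<le> 3 \<and> - 3 \<le> y \<and> y \<le> 3"
    using eisenstein_norm_bound[of x y 7 3] le by simp
  then have "x \<in> {-3, -2, -1, 0, 1, 2, 3}" "y \<in> {-3, -2, -1, 0, 1, 2, 3}" by auto
  then show ?thesis using r le unfolding hexagonal_classes_def norm_7_points_def by (elim insertE emptyE) simp_all
qed

lemma hexagonal_classes_distinct:
  assumes "p \<in> hexagonal_classes" "r \<in> hexagonal_classes" "5 dvd fst p - fst r" "5 dvd snd p - snd r"
  shows "p = r"
  using assms unfolding hexagonal_classes_def by (elim insertE emptyE) simp_all

text \<open>Six double classes give twelve vertices; removing the class of (3, - 2) takes (3, - 2)
  and (- 2, 3) with it.\<close>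

lemma crystal_5_example:
  "\<exists>S :: (real ^ 2) set. crystal 5 S \<and> enat 10 \<le> helly_number S"
proof -
  let ?R = "hexagonal_classes - {(3, - 2)}" and ?V = "norm_7_points - {(3, - 2), (- 2, 3)}"
  have "\<exists>S :: (real ^ 2) set. crystal (card ?R) S \<and> enat (card ?V) \<le> helly_number S"
  proof (rule integer_ellipse_example[where N = 5 and c = 1 and n = 7])
    fix x y :: int and r
    assume r: "r \<in> ?R" "5 dvd x - fst r" "5 dvd y - snd r" and le: "x * x + 1 * x * y + y * y \<le> 7"
    then have "(x, y) \<in> norm_7_points" using norm_le_7_in_hexagonal_class[of r x y] by simp
    moreover have "r \<in> hexagonal_classes" "r \<noteq> (3, - 2)" using r(1) by auto
    ultimately show "(x, y) \<in> ?V"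
      using r(2,3) unfolding norm_7_points_def hexagonal_classes_def by (elim insertE emptyE) simp_all
  next
    fix x y assume "(x, y) \<in> ?V"
    then have "(x, y) \<in> norm_7_points" "(x, y) \<noteq> (3, - 2)" "(x, y) \<noteq> (- 2, 3)" by auto
    then show "x * x + 1 * x * y + y * y = 7 \<and> (\<exists>r\<in>?R. 5 dvd x - fst r \<and> 5 dvd y - snd r)"
      unfolding norm_7_points_def hexagonal_classes_def by (elim insertE emptyE) (simp_all add: insert_Diff_if)
  next
    fix p r assume "p \<in> ?R" "r \<in> ?R" "5 dvd fst p - fst r" "5 dvd snd p - snd r"
    then show "p = r" using hexagonal_classes_distinct by blast
  qed (auto simp: hexagonal_classes_def norm_7_points_def)
  moreover have "card ?R = 5" "card ?V = 10" by (simp_all add: hexagonal_classes_def norm_7_points_def insert_Diff_if)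
  ultimately show ?thesis by (simp only:)
qed


section \<open>Six and more translates: extra points on an arc\<close>

lemma qform_1_bound:
  assumes "qform 1 z \<le> 7"
  shows "\<bar>z $ 1\<bar> < 4" "\<bar>z $ 2\<bar> < 4"
proof -
  have "4 * qform 1 z = 3 * (z $ 1)\<^sup>2 + (z $ 1 + 2 * z $ 2)\<^sup>2"
    "4 * qform 1 z = 3 * (z $ 2)\<^sup>2 + (z $ 2 + 2 * z $ 1)\<^sup>2"
    by (simp_all add: qform_def power2_eq_square algebra_simps)
  then have "3 * (z $ 1)\<^sup>2 \<le> 28" "3 * (z $ 2)\<^sup>2 \<le> 28"
    using assms zero_le_power2[of "z $ 1 + 2 * z $ 2"] zero_le_power2[of "z $ 2 + 2 * z $ 1"] by linarith+
  then have "(z $ 1)\<^sup>2 < 4\<^sup>2" "(z $ 2)\<^sup>2 < 4\<^sup>2" by simp_all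
  then show "\<bar>z $ 1\<bar> < 4" "\<bar>z $ 2\<bar> < 4" using power2_less_imp_less[of "\<bar>z $ 1\<bar>" 4] power2_less_imp_less[of "\<bar>z $ 2\<bar>" 4] by auto
qed

text \<open>The open arc between the integer points (2, 1) and (1, 2). The strict bounds exclude
  integer points; each further translate is placed here and adds one vertex.\<close>

definition arc :: "(real ^ 2) set" where
  "arc = {z. 1 < z $ 1 \<and> z $ 1 < 2 \<and> 1 < z $ 2 \<and> z $ 2 < 2 \<and> qform 1 z = 7}"

lemma infinite_arc: "infinite arc"
proof
  assume "finite arc"
  \<comment> \<open>For 1 < x < 2 this is the positive root y of x^2 + x y + y^2 = 7. The factored
    inequalities below amount to 1 < \<open>f x\<close> < 2.\<close>
  define f :: "real \<Rightarrow> real" where "f x = (sqrt (28 - 3 * x\<^sup>2) - x) / 2" for x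
  have "{1<..<2} \<subseteq> (\<lambda>z. z $ 1) ` arc"
  proof
    fix x :: real assume x: "x \<in> {1<..<2}"
    then have x2: "x * x < 4" using mult_strict_mono[of x 2 x 2] by simp
    have "(x + 3) * (x - 2) < 0" "0 < (x + 3) * (x - 1)"
      using x by (auto intro: mult_pos_neg mult_pos_pos)
    then have "(2 + x)\<^sup>2 < 28 - 3 * x\<^sup>2" "28 - 3 * x\<^sup>2 < (4 + x)\<^sup>2"
      by (simp_all add: power2_eq_square algebra_simps)
    then have "2 + x < sqrt (28 - 3 * x\<^sup>2)" "sqrt (28 - 3 * x\<^sup>2) < 4 + x"
      using x by (auto intro: real_less_rsqrt real_less_lsqrt)
    then have f: "1 < f x" "f x < 2" by (simp_all add: f_def)
    have "2 * f x + x = sqrt (28 - 3 * x\<^sup>2)" by (simp add: f_def field_simps)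
    then have "(2 * f x + x)\<^sup>2 = 28 - 3 * x\<^sup>2"
      using x2 by (simp add: power2_eq_square)
    then have "qform 1 (pt x (f x)) = 7" by (simp add: qform_def power2_eq_square algebra_simps)
    then have "pt x (f x) \<in> arc" using x f by (simp add: arc_def)
    then show "x \<in> (\<lambda>z. z $ 1) ` arc" by (intro image_eqI[of _ _ "pt x (f x)"]) auto
  qed
  then have "finite {1<..<2 :: real}" using \<open>finite arc\<close> finite_surj by blast
  then show False using infinite_Ioo[of 1 "2 :: real"] by simp
qed

lemma arc_below_chord:
  assumes "1 < x" "x < 2" "1 < y" "qform 1 (pt x y) = 7"
  shows "2 * x + y < 5"
proof (rule ccontr)
  assume "\<not> ?thesis"
  then have "0 \<le> (y - (5 - 2 * x)) * (x + y + (5 - 2 * x))" using assms by simp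
  \<comment> \<open>On the line itself the form is 7 + 3 (2 - x) (3 - x), which exceeds 7 for x < 2;
    the first product is the change off the line.\<close>
  moreover have "qform 1 (pt x y) = (y - (5 - 2 * x)) * (x + y + (5 - 2 * x)) + 3 * ((2 - x) * (3 - x)) + 7"
    by (simp add: qform_def power2_eq_square algebra_simps)
  moreover have "0 < (2 - x) * (3 - x)" using assms by simp
  ultimately show False using assms(4) by linarith
qed

text \<open>The coordinate bounds leave only shifts by 0 or - 5 in each coordinate. A nonzero one
  increases the form, because the arc lies on the near side of the bisectors 2 x + y = 5, x + 2 y =
  5 and x + y = 5.\<close>

lemma arc_translates_outside:
  assumes z: "z \<in> arc" and g: "g \<in> grid 5" and le: "qform 1 (z + g) \<le> 7"
  shows "g = 0"
proof -
  obtain i j :: int where g: "g = pt (5 * i) (5 * j)" using g by (auto simp: grid_def)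
  define x y where "x = z $ 1" and "y = z $ 2"
  have xy: "1 < x" "x < 2" "1 < y" "y < 2" "qform 1 (pt x y) = 7"
    using z by (auto simp: arc_def x_def y_def pt_collapse)
  have "qform 1 (pt y x) = 7" using xy(5) by (simp add: qform_def algebra_simps)
  then have t: "2 * x + y < 5" "2 * y + x < 5"
    using arc_below_chord[of x y] arc_below_chord[of y x] xy by auto
  have zg: "z + g = pt (x + 5 * i) (y + 5 * j)"
    by (simp add: g x_def y_def vec_eq_iff forall_2)
  have "\<bar>x + 5 * i\<bar> < 4" "\<bar>y + 5 * j\<bar> < 4"
    using qform_1_bound[OF le] by (simp_all add: zg)
  then have "- 2 < real_of_int i" "real_of_int i < 1" "- 2 < real_of_int j" "real_of_int j < 1" using xy by auto
  then have "i = -1 \<or> i = 0" "j = -1 \<or> j = 0" by linarith+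
  moreover have "qform 1 (pt (x - 5) y) = qform 1 (pt x y) + 5 * (5 - (2 * x + y))"
    "qform 1 (pt x (y - 5)) = qform 1 (pt x y) + 5 * (5 - (2 * y + x))"
    "qform 1 (pt (x - 5) (y - 5)) = qform 1 (pt x y) + 15 * (5 - (x + y))"
    by (simp_all add: qform_def power2_eq_square algebra_simps)
  ultimately have "i = 0 \<and> j = 0" using le xy t by (auto simp: zg)
  then show ?thesis by (simp add: g vec_eq_iff forall_2)
qed

text \<open>Each of the \<open>k - 6\<close> arc points opens a translate with this point as its
  only vertex, next to twelve vertices from the six double classes.\<close>

lemma crystal_ge_6_example:
  assumes "k \<ge> 6"
  shows "\<exists>S :: (real ^ 2) set. crystal k S \<and> enat (k + 6) \<le> helly_number S"
proof -
  obtain A where A: "A \<subseteq> arc" "finite A" "card A = k - 6"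
    using infinite_arbitrarily_large[OF infinite_arc] by blast
  define R where "R = ipt ` hexagonal_classes \<union> A"
  define V where "V = ipt ` norm_7_points \<union> A"
  have not_int: "ipt p \<notin> arc" for p
  proof
    assume "ipt p \<in> arc"
    then have "1 < real_of_int (fst p)" "real_of_int (fst p) < 2" by (auto simp: arc_def ipt_def)
    then have "1 < fst p" "fst p < 2" by simp_all
    then show False by linarith
  qed
  have card: "card (ipt ` B \<union> A) = card B + (k - 6)" if "finite B" for B
  proof -
    have "card (ipt ` B) = card B" using inj_ipt by (metis card_image inj_on_subset subset_UNIV)
    moreover have "ipt ` B \<inter> A = {}" using not_int A(1) by auto
    ultimately show ?thesis using A that by (subst card_Un_disjoint) auto
  qed
  have fin: "finite hexagonal_classes" "finite norm_7_points"
    by (auto simp: hexagonal_classes_def norm_7_points_def)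
  have "card hexagonal_classes = 6" "card norm_7_points = 12"
    by (simp_all add: hexagonal_classes_def norm_7_points_def)
  then have cards: "card R = k" "card V = k + 6"
    using card[OF fin(1)] card[OF fin(2)] assms by (auto simp: R_def V_def)
  have on: "qform 1 v = 7" if v: "v \<in> V" for v
  proof (cases "v \<in> A")
    case True
    then show ?thesis using A(1) by (auto simp: arc_def)
  next
    case False
    then obtain x y where "v = ipt (x, y)" "(x, y) \<in> norm_7_points" using v by (auto simp: V_def)
    then show ?thesis using norm_7_points[of x y] qform_1_ipt[of x y] by simp
  qed
  have RV: "R \<subseteq> V"
    unfolding R_def V_def by (intro Un_mono image_mono) (auto simp: hexagonal_classes_def norm_7_points_def)
  \<comment> \<open>Stated for either sign of the difference, so that it applies whichever of the
    two representatives lies on the arc.\<close>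
  have arc_only: "r = s" if "r \<in> arc" "qform 1 s = 7" "r - s \<in> grid 5 \<or> s - r \<in> grid 5" for r s
  proof -
    obtain g where g: "g \<in> grid 5" "s = r + g"
    proof (cases "s - r \<in> grid 5")
      case True
      then show thesis using that[of "s - r"] by simp
    next
      case False
      then have "r - s \<in> grid 5" using \<open>_ \<or> _\<close> by simp
      then obtain i j where "r - s = pt (of_int (5 * i)) (of_int (5 * j))" by (auto simp: grid_def)
      then have "s - r = pt (of_int (5 * (- i))) (of_int (5 * (- j)))"
        by (simp add: vec_eq_iff forall_2)
      then have "s - r \<in> grid 5" unfolding grid_def by blast
      then show thesis using False by simp
    qed
    then have "g = 0" using arc_translates_outside[OF that(1) g(1)] that(2) by simp
    then show ?thesis using g by simp
  qed
  have "crystal (card R) (grid_translates 5 R)"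
  proof (rule crystal_grid_translates)
    show "finite R" using fin A by (simp add: R_def)
    fix r s assume rs: "r \<in> R" "s \<in> R" "r - s \<in> grid 5"
    show "r = s"
    proof (cases "r \<in> A \<or> s \<in> A")
      case True
      then show ?thesis using arc_only[of r s] arc_only[of s r] A(1) on RV rs by auto
    next
      case False
      then obtain p q where "p \<in> hexagonal_classes" "q \<in> hexagonal_classes" "r = ipt p" "s = ipt q"
        using rs by (auto simp: R_def)
      then show ?thesis using rs(3) hexagonal_classes_distinct[of p q] by (simp add: ipt_diff_in_grid)
    qed
  qed simp
  moreover have "empty_polytope (grid_translates 5 R) V"
  proof (rule empty_polytope_on_ellipse[of 1 _ _ 7])
    show "finite V" using fin A by (simp add: V_def)
    show "V \<subseteq> grid_translates 5 R"
    proof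
      fix v assume v: "v \<in> V"
      show "v \<in> grid_translates 5 R"
      proof (cases "v \<in> A")
        case True
        have "0 = pt (of_int (5 * 0)) (of_int (5 * 0))" by (simp add: vec_eq_iff forall_2)
        then have "0 \<in> grid 5" unfolding grid_def by blast
        then have "0 + v \<in> (\<lambda>x. x + v) ` grid 5" by blast
        then show ?thesis using True by (auto simp: grid_translates_def R_def)
      next
        case False
        then obtain x y where xy: "v = ipt (x, y)" "(x, y) \<in> norm_7_points" using v by (auto simp: V_def)
        then have "v \<in> grid_translates 5 (ipt ` hexagonal_classes)"
          unfolding grid_translates_ipt using norm_7_points_class[OF xy(2)] by (metis fst_conv snd_conv)
        then show ?thesis by (auto simp: grid_translates_def R_def)
      qed
    qed
    fix z assume z: "z \<in> grid_translates 5 R" "qform 1 z \<le> 7"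
    then obtain r g where r: "r \<in> R" "g \<in> grid 5" "z = r + g"
      by (auto simp: grid_translates_def add.commute)
    show "z \<in> V"
    proof (cases "r \<in> A")
      case True
      then have "g = 0" using arc_translates_outside[of r g] r z A(1) by auto
      then show ?thesis using True r by (simp add: V_def)
    next
      case False
      then have "z \<in> grid_translates 5 (ipt ` hexagonal_classes)"
        using r by (auto simp: grid_translates_def R_def add.commute)
      then obtain x y p where p: "p \<in> hexagonal_classes" "z = ipt (x, y)" "5 dvd x - fst p" "5 dvd y - snd p"
        unfolding grid_translates_ipt by auto
      have "x * x + x * y + y * y \<le> 7"
        using z(2) unfolding p(2) qform_1_ipt by (simp only: of_int_le_numeral_iff)
      then show ?thesis using norm_le_7_in_hexagonal_class[of p x y] p by (auto simp: V_def)
    qed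
  qed (use on in auto)
  ultimately show ?thesis using helly_number_ge cards by metis
qed

subsection \<open>Three and four translates\<close>

text \<open>The class of (0, 0) contributes a triangle and each other class one chord, parallel to a side
  of the triangle; omitting the class of (3, 3) leaves seven vertices for three translates.\<close>

definition nonagon :: "(int \<times> int) set" where
  "nonagon = {(- 1, 2), (0, 0), (2, - 1), (3, - 1), (4, 0), (3, 2), (2, 3), (0, 4), (- 1, 3)}"

definition nonagon_classes :: "(int \<times> int) set" where
  "nonagon_classes = {(0, 0), (3, 2), (2, 3), (3, 3)}"

lemma nonagon_classes_distinct:
  assumes "p \<in> nonagon_classes" "r \<in> nonagon_classes" "4 dvd fst p - fst r" "4 dvd snd p - snd r"
  shows "p = r"
  using assms unfolding nonagon_classes_def by (elim insertE emptyE) simp_all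

text \<open>These are the nine edge inequalities in order around the polygon: each holds at all
  vertices and hence on the hull.\<close>

lemma nonagon_hull:
  fixes x y :: int
  assumes "ipt (x, y) \<in> convex hull (ipt ` nonagon)"
  shows "0 \<le> 2 * x + y" "0 \<le> x + 2 * y" "- 1 \<le> y" "x - y \<le> 4" "2 * x + y \<le> 8" "x + y \<le> 5"
    "x + 2 * y \<le> 8" "y - x \<le> 4" "- 1 \<le> x"
proof -
  have half: "a * x + b * y \<le> c" if "\<And>p. p \<in> nonagon \<Longrightarrow> a * fst p + b * snd p \<le> c" for a b c :: int
  proof -
    have "ipt ` nonagon \<subseteq> {z. pt (of_int a) (of_int b) \<bullet> z \<le> of_int c}"
    proof safe
      fix u v assume "(u, v) \<in> nonagon"
      then have "real_of_int (a * u + b * v) \<le> of_int c" using that[of "(u, v)"] by (simp only: of_int_le_iff fst_conv snd_conv)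
      then show "pt (of_int a) (of_int b) \<bullet> ipt (u, v) \<le> of_int c" by (simp add: inner_pt ipt_def)
    qed
    then have "convex hull (ipt ` nonagon) \<subseteq> {z. pt (of_int a) (of_int b) \<bullet> z \<le> of_int c}"
      by (intro hull_minimal convex_halfspace_le)
    then have "real_of_int (a * x + b * y) \<le> of_int c" using assms by (auto simp: inner_pt ipt_def)
    then show ?thesis by (simp only: of_int_le_iff)
  qed
  have 1: "- 2 * x + - 1 * y \<le> 0" by (rule half) (auto simp: nonagon_def)
  have 2: "- 1 * x + - 2 * y \<le> 0" by (rule half) (auto simp: nonagon_def)
  have 3: "0 * x + - 1 * y \<le> 1" by (rule half) (auto simp: nonagon_def)
  have 4: "1 * x + - 1 * y \<le> 4" by (rule half) (auto simp: nonagon_def)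
  have 5: "2 * x + 1 * y \<le> 8" by (rule half) (auto simp: nonagon_def)
  have 6: "1 * x + 1 * y \<le> 5" by (rule half) (auto simp: nonagon_def)
  have 7: "1 * x + 2 * y \<le> 8" by (rule half) (auto simp: nonagon_def)
  have 8: "- 1 * x + 1 * y \<le> 4" by (rule half) (auto simp: nonagon_def)
  have 9: "- 1 * x + 0 * y \<le> 1" by (rule half) (auto simp: nonagon_def)
  show "0 \<le> 2 * x + y" "0 \<le> x + 2 * y" "- 1 \<le> y" "x - y \<le> 4" "2 * x + y \<le> 8" "x + y \<le> 5"
    "x + 2 * y \<le> 8" "y - x \<le> 4" "- 1 \<le> x" using 1 2 3 4 5 6 7 8 9 by linarith+
qed

text \<open>For each vertex the pair \<open>(a, b)\<close> is the sum of the outer normals of its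
  two edges, divided by common factors.\<close>

lemma nonagon_exposed:
  assumes "v \<in> nonagon"
  shows "\<exists>a b :: int. \<forall>w\<in>nonagon - {v}. a * fst w + b * snd w < a * fst v + b * snd v"
proof -
  have *: ?thesis if "\<forall>w\<in>nonagon - {v}. a * fst w + b * snd w < a * fst v + b * snd v" for a b
    using that by blast
  note simps = nonagon_def insert_Diff_if
  from assms[unfolded nonagon_def] show ?thesis
  proof (elim insertE emptyE)
    assume "v = (- 1, 2)"
    then show ?thesis by (intro *[of "- 3" "- 1"]) (simp add: simps)
  next
    assume "v = (0, 0)"
    then show ?thesis by (intro *[of "- 1" "- 1"]) (simp add: simps)
  next
    assume "v = (2, - 1)"
    then show ?thesis by (intro *[of "- 1" "- 3"]) (simp add: simps)
  next
    assume "v = (3, - 1)"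
    then show ?thesis by (intro *[of 1 "- 2"]) (simp add: simps)
  next
    assume "v = (4, 0)"
    then show ?thesis by (intro *[of 1 0]) (simp add: simps)
  next
    assume "v = (3, 2)"
    then show ?thesis by (intro *[of 3 2]) (simp add: simps)
  next
    assume "v = (2, 3)"
    then show ?thesis by (intro *[of 2 3]) (simp add: simps)
  next
    assume "v = (0, 4)"
    then show ?thesis by (intro *[of 0 1]) (simp add: simps)
  next
    assume "v = (- 1, 3)"
    then show ?thesis by (intro *[of "- 2" 1]) (simp add: simps)
  qed
qed

lemma nonagon_empty:
  "empty_polytope (grid_translates 4 (ipt ` nonagon_classes)) (ipt ` nonagon)"
proof (rule empty_polytope_if_exposed)
  show "finite (ipt ` nonagon)" by (simp add: nonagon_def)
  show "ipt ` nonagon \<subseteq> grid_translates 4 (ipt ` nonagon_classes)"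
  proof safe
    fix x y assume "(x, y) \<in> nonagon"
    then have "\<exists>r\<in>nonagon_classes. 4 dvd x - fst r \<and> 4 dvd y - snd r"
      unfolding nonagon_def nonagon_classes_def by (elim insertE emptyE) simp_all
    then show "ipt (x, y) \<in> grid_translates 4 (ipt ` nonagon_classes)"
      unfolding grid_translates_ipt by (metis fst_conv snd_conv)
  qed
  show "grid_translates 4 (ipt ` nonagon_classes) \<inter> convex hull (ipt ` nonagon) \<subseteq> ipt ` nonagon"
  proof safe
    fix z assume z: "z \<in> grid_translates 4 (ipt ` nonagon_classes)" "z \<in> convex hull (ipt ` nonagon)"
    then obtain x y r where r: "r \<in> nonagon_classes" "4 dvd x - fst r" "4 dvd y - snd r" and xy: "z = ipt (x, y)"
      unfolding grid_translates_ipt by auto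
    note h = nonagon_hull[OF z(2)[unfolded xy]]
    \<comment> \<open>The upper bounds 4 follow by adding the inequalities of the two edges at (4,
      0), respectively at (0, 4).\<close>
    have "x \<in> {-1, 0, 1, 2, 3, 4}" "y \<in> {-1, 0, 1, 2, 3, 4}" using h by auto
    then have "(x, y) \<in> nonagon"
      using r h unfolding nonagon_classes_def nonagon_def by (elim insertE emptyE) simp_all
    then show "z \<in> ipt ` nonagon" using xy by blast
  qed
  fix v assume "v \<in> ipt ` nonagon"
  then obtain p where p: "p \<in> nonagon" "v = ipt p" by blast
  obtain a b where ab: "\<forall>w\<in>nonagon - {p}. a * fst w + b * snd w < a * fst p + b * snd p"
    using nonagon_exposed[OF p(1)] by blast
  have "pt (of_int a) (of_int b) \<bullet> w < pt (of_int a) (of_int b) \<bullet> v" if w: "w \<in> ipt ` nonagon - {v}" for w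
  proof -
    obtain q where q: "q \<in> nonagon - {p}" "w = ipt q" using w p(2) by auto
    then have "real_of_int (a * fst q + b * snd q) < of_int (a * fst p + b * snd p)"
      using ab by (simp only: of_int_less_iff)
    then show ?thesis by (simp add: inner_pt ipt_def p q)
  qed
  then show "\<exists>a. \<forall>w\<in>ipt ` nonagon - {v}. a \<bullet> w < a \<bullet> v" by blast
qed

lemma nonagon_crystal:
  assumes "R \<subseteq> nonagon_classes"
  shows "crystal (card R) (grid_translates 4 (ipt ` R))"
proof -
  have "crystal (card (ipt ` R)) (grid_translates 4 (ipt ` R))"
  proof (rule crystal_grid_translates)
    show "finite (ipt ` R)" using assms finite_subset by (fastforce simp: nonagon_classes_def)
    fix a b assume "a \<in> ipt ` R" "b \<in> ipt ` R" "a - b \<in> grid 4"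
    then obtain p q where "p \<in> R" "q \<in> R" "a = ipt p" "b = ipt q" "ipt p - ipt q \<in> grid 4" by auto
    then show "a = b" using nonagon_classes_distinct[of p q] assms by (auto simp: ipt_diff_in_grid)
  qed simp
  moreover have "card (ipt ` R) = card R" using inj_ipt by (metis card_image inj_on_subset subset_UNIV)
  ultimately show ?thesis by simp
qed

lemma crystal_4_example:
  "\<exists>S :: (real ^ 2) set. crystal 4 S \<and> enat 9 \<le> helly_number S"
proof -
  have "card nonagon_classes = 4" by (simp add: nonagon_classes_def)
  moreover have "card (ipt ` nonagon) = card nonagon"
    using inj_ipt by (metis card_image inj_on_subset subset_UNIV)
  then have "card (ipt ` nonagon) = 9" by (simp add: nonagon_def)
  ultimately show ?thesis
    using nonagon_crystal[of nonagon_classes] helly_number_ge[OF nonagon_empty] by auto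
qed

lemma crystal_3_example:
  "\<exists>S :: (real ^ 2) set. crystal 3 S \<and> enat 7 \<le> helly_number S"
proof -
  let ?R = "nonagon_classes - {(3, 3)}" and ?V = "nonagon - {(3, - 1), (- 1, 3)}"
  let ?S = "grid_translates 4 (ipt ` ?R)"
  have "?S \<subseteq> grid_translates 4 (ipt ` nonagon_classes)" by (auto simp: grid_translates_def)
  then have "empty_polytope ?S (ipt ` nonagon \<inter> ?S)" by (rule empty_polytope_restrict[OF nonagon_empty])
  moreover have "ipt ` nonagon \<inter> ?S = ipt ` ?V"
  proof -
    have "ipt (x, y) \<in> ?S \<longleftrightarrow> (x, y) \<in> ?V" if "(x, y) \<in> nonagon" for x y
    proof -
      have "ipt (x, y) \<in> ?S \<longleftrightarrow> (\<exists>r\<in>?R. 4 dvd x - fst r \<and> 4 dvd y - snd r)"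
        unfolding grid_translates_ipt inj_eq[OF inj_ipt] by (metis fst_conv snd_conv)
      also have "\<dots> \<longleftrightarrow> (x, y) \<in> ?V"
        using that unfolding nonagon_def nonagon_classes_def
        by (elim insertE emptyE) (simp_all add: insert_Diff_if)
      finally show ?thesis .
    qed
    then show ?thesis by auto
  qed
  moreover have "card (ipt ` ?V) = card ?V" using inj_ipt by (metis card_image inj_on_subset subset_UNIV)
  moreover have "card ?V = 7" by (simp add: nonagon_def insert_Diff_if)
  moreover have "card ?R = 3" by (simp add: nonagon_classes_def insert_Diff_if)
  ultimately show ?thesis
    using nonagon_crystal[of ?R] helly_number_ge[of ?S "ipt ` ?V"] by auto
qed

theorem mainTheorem4:
  fixes k :: nat
  assumes "k \<ge> 1"
  shows "let m = enat (if k = 1 then 4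
                       else if k = 2 then 6
                       else if k = 3 then 7
                       else if k = 4 then 9
                       else if k = 5 then 10
                       else k + 6)
         in (\<forall>S :: (real ^ 2) set. crystal k S \<longrightarrow> helly_number S \<le> m) \<and>
            (\<exists>S :: (real ^ 2) set. crystal k S \<and> helly_number S = m)"
proof -
  define m where "m = max_helly k"
  have m: "m = (if k = 1 then 4 else if k = 2 then 6 else if k = 3 then 7 else if k = 4 then 9
      else if k = 5 then 10 else k + 6)"
    using assms by (auto simp: m_def max_helly_def)
  have upper: "\<forall>S :: (real ^ 2) set. crystal k S \<longrightarrow> helly_number S \<le> enat m"
    using crystal_helly_number_le assms by (auto simp: m_def)
  consider "k = 1" | "k = 2" | "k = 3" | "k = 4" | "k = 5" | "k \<ge> 6" using assms by linarith
  then have "\<exists>S :: (real ^ 2) set. crystal k S \<and> enat m \<le> helly_number S"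
  proof cases
    case 1 then show ?thesis using crystal_1_example by (simp add: m)
  next
    case 2 then show ?thesis using crystal_2_example by (simp add: m)
  next
    case 3 then show ?thesis using crystal_3_example by (simp add: m)
  next
    case 4 then show ?thesis using crystal_4_example by (simp add: m)
  next
    case 5 then show ?thesis using crystal_5_example by (simp add: m)
  next
    case 6 then show ?thesis using crystal_ge_6_example[of k] by (simp add: m)
  qed
  then have "\<exists>S :: (real ^ 2) set. crystal k S \<and> helly_number S = enat m"
    using upper antisym by blast
  then show ?thesis using upper unfolding m[symmetric] Let_def by blast
qed

end
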